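(* Let $(M,g)$ be a connected pseudo-Riemannian manifold, let $\varepsilon'\in\{1,-1\}$, and let $\bar M=M\times\mathbb{R}$ carry the metric $\langle\,,\rangle=g+\varepsilon' dt^2$. Let $u\in C^2(M,\mathbb{R})$ and let $F:M\to\bar M$, $F(p)=(p,u(p))$, be its graph map. Assume that $F$ is a non-degenerate hypersurface and that $\varepsilon:=\mathrm{sign}(\varepsilon'+|\nabla u|_g^2)\in\{1,-1\}$ is constant on $M$. Then $F$ is a (vertical) translating soliton if, and only if, $u$ satisfies $$\mathrm{div}\left(\frac{\nabla u}{\sqrt{\varepsilon(\varepsilon'+|\nabla u|_g^2)}}\right)=\frac{1}{\sqrt{\varepsilon(\varepsilon'+|\nabla u|_g^2)}}=H .$$
   Context: $\nabla u$ and $\mathrm{div}$ are the gradient and divergence with respect to $g$, and $|w|_g^2:=g(w,w)$ (which may be negative). $F$ is non-degenerate if the induced metric $\gamma=F^*\langle\,,\rangle$ is non-degenerate. The upward unit normal is $\nu=\frac1W(-\varepsilon'\nabla u,1)$ with $W=+\sqrt{\varepsilon(\varepsilon'+|\nabla u|_g^2)}$; it satisfies $\langle\nu,\nu\rangle=\varepsilon$. The mean curvature vector is $\vec H=\mathrm{trace}_\gamma(II)$ (not normalized by the dimension), where $II$ is the second fundamental form of $F$, and the mean curvature function $H$ is defined by $\vec H=\varepsilon H\nu$. $F$ is a (vertical) translating soliton if $\vec H=\partial_t^{\perp}$, where $\partial_t^\perp$ is the component of $\partial_t$ normal to $F$.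
   Formalization: The last equality is proved as 1/√(ε(ε'+|∇u|²)) = ε'H instead of = H: with the stated normal ν and vec H = εHν, a soliton has H = ε'/W, so the printed equality fails for ε' = −1 (e.g. u = ln cosh x on M = ℝ, g = dx²); for ε' = 1 nothing changes. *)

theory Defs
  imports "HOL-Analysis.Analysis"
begin

section \<open>Differentiability classes on open sets\<close>

primrec C_k_on :: "nat \<Rightarrow> 'e::euclidean_space set \<Rightarrow> ('e \<Rightarrow> 'f::real_normed_vector) \<Rightarrow> bool" where
  "C_k_on 0 S f \<longleftrightarrow> continuous_on S f"
| "C_k_on (Suc k) S f \<longleftrightarrow>
     (\<forall>x\<in>S. f differentiable (at x)) \<and>
     (\<forall>v. C_k_on k S (\<lambda>x. frechet_derivative f (at x) v))"

definition smooth_on :: "'e::euclidean_space set \<Rightarrow> ('e \<Rightarrow> 'f::real_normed_vector) \<Rightarrow> bool" where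
  "smooth_on S f \<longleftrightarrow> (\<forall>k. C_k_on k S f)"

section \<open>Manifolds\<close>

type_synonym ('a, 'e) chart = "'a set \<times> ('a \<Rightarrow> 'e)"

abbreviation chart_dom :: "('a, 'e) chart \<Rightarrow> 'a set" where
  "chart_dom c \<equiv> fst c"

abbreviation chart_map :: "('a, 'e) chart \<Rightarrow> 'a \<Rightarrow> 'e" where
  "chart_map c \<equiv> snd c"

definition chart_inv :: "('a, 'e) chart \<Rightarrow> 'e \<Rightarrow> 'a" where
  "chart_inv c = inv_into (chart_dom c) (chart_map c)"

definition is_chart :: "('a::topological_space, 'e::euclidean_space) chart \<Rightarrow> bool" where
  "is_chart c \<longleftrightarrow>
     open (chart_dom c) \<and> open (chart_map c ` chart_dom c) \<and>
     homeomorphism (chart_dom c) (chart_map c ` chart_dom c) (chart_map c) (chart_inv c)"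

definition transition :: "('a, 'e) chart \<Rightarrow> ('a, 'e) chart \<Rightarrow> 'e \<Rightarrow> 'e" where
  "transition c d = chart_map d \<circ> chart_inv c"

text \<open>Atlases need not be maximal.\<close>

definition smooth_atlas :: "('a::topological_space, 'e::euclidean_space) chart set \<Rightarrow> bool" where
  "smooth_atlas A \<longleftrightarrow>
     (\<forall>c\<in>A. is_chart c) \<and>
     (\<forall>c\<in>A. \<forall>d\<in>A.
        smooth_on (chart_map c ` (chart_dom c \<inter> chart_dom d)) (transition c d))"

definition manifold_points :: "('a, 'e) chart set \<Rightarrow> 'a set" where
  "manifold_points A = (\<Union>c\<in>A. chart_dom c)"

text \<open>A scalar built from components of tensors is evaluated in this chart; the choice does
  not affect the value.\<close>

definition chart_at :: "('a, 'e) chart set \<Rightarrow> 'a \<Rightarrow> ('a, 'e) chart" where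
  "chart_at A p = (SOME c. c \<in> A \<and> p \<in> chart_dom c)"

definition C_k_function ::
  "nat \<Rightarrow> ('a, 'e::euclidean_space) chart set \<Rightarrow> ('a \<Rightarrow> real) \<Rightarrow> bool" where
  "C_k_function k A u \<longleftrightarrow>
     (\<forall>c\<in>A. C_k_on k (chart_map c ` chart_dom c) (u \<circ> chart_inv c))"

section \<open>Bilinear forms on a finite-dimensional vector space\<close>

definition nondegenerate :: "('e::euclidean_space \<Rightarrow> 'e \<Rightarrow> real) \<Rightarrow> bool" where
  "nondegenerate B \<longleftrightarrow> (\<forall>v. (\<forall>w. B v w = 0) \<longrightarrow> v = 0)"

definition sharp ::
  "('e::euclidean_space \<Rightarrow> 'e \<Rightarrow> real) \<Rightarrow> ('e \<Rightarrow> real) \<Rightarrow> 'e" where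
  "sharp B \<alpha> = (THE z. \<forall>v. B z v = \<alpha> v)"

text \<open>The usual \<open>\<Sum>\<^sub>i\<^sub>j \<gamma>\<^sup>i\<^sup>j Q(e\<^sub>i, e\<^sub>j)\<close> for bilinear \<open>Q\<close>: raising the index of the
  covector dual to \<open>e\<^sub>i\<close> gives \<open>\<Sum>\<^sub>j \<gamma>\<^sup>i\<^sup>j e\<^sub>j\<close>.\<close>

definition trace_wrt ::
  "('e::euclidean_space \<Rightarrow> 'e \<Rightarrow> real) \<Rightarrow> ('e \<Rightarrow> 'e \<Rightarrow> 'f::real_vector) \<Rightarrow> 'f" where
  "trace_wrt \<gamma> Q = (\<Sum>b\<in>Basis. Q b (sharp \<gamma> (\<lambda>v. b \<bullet> v)))"

text \<open>Component of \<open>w\<close> that is \<open>B\<close>-orthogonal to the range of \<open>D\<close>, along that range.\<close>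

definition normal_component ::
  "('f::euclidean_space \<Rightarrow> 'f \<Rightarrow> real) \<Rightarrow> ('e \<Rightarrow> 'f) \<Rightarrow> 'f \<Rightarrow> 'f" where
  "normal_component B D w = (THE n. (\<forall>v. B n (D v) = 0) \<and> (\<exists>v. w = n + D v))"

section \<open>Pseudo-Riemannian manifolds\<close>

text \<open>Tensor fields are families of components: \<open>X c p\<close> is the component vector at \<open>p\<close>, in
  the chart \<open>c\<close>, of a vector field \<open>X\<close>, and \<open>g c p\<close> is the bilinear form on the model space
  that represents a metric \<open>g\<close> at \<open>p\<close>.\<close>

type_synonym ('a, 'e) vfield = "('a, 'e) chart \<Rightarrow> 'a \<Rightarrow> 'e"
type_synonym ('a, 'e) metric = "('a, 'e) chart \<Rightarrow> 'a \<Rightarrow> 'e \<Rightarrow> 'e \<Rightarrow> real"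

text \<open>On a connected manifold the index of the metric is constant by nondegeneracy and
  continuity.\<close>

definition pseudo_riemannian_metric ::
  "('a, 'e::euclidean_space) chart set \<Rightarrow> ('a, 'e) metric \<Rightarrow> bool" where
  "pseudo_riemannian_metric A g \<longleftrightarrow>
     (\<forall>c\<in>A. \<forall>p\<in>chart_dom c.
        bilinear (g c p) \<and> (\<forall>v w. g c p v w = g c p w v) \<and> nondegenerate (g c p)) \<and>
     (\<forall>c\<in>A. \<forall>v w. smooth_on (chart_map c ` chart_dom c) (\<lambda>x. g c (chart_inv c x) v w)) \<and>
     (\<forall>c\<in>A. \<forall>d\<in>A. \<forall>p\<in>chart_dom c \<inter> chart_dom d. \<forall>v w.
        g c p v w =
          g d p (frechet_derivative (transition c d) (at (chart_map c p)) v)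
                (frechet_derivative (transition c d) (at (chart_map c p)) w))"

definition pseudo_riemannian_manifold ::
  "('a::{t2_space, second_countable_topology}, 'e::euclidean_space) chart set \<Rightarrow>
   ('a, 'e) metric \<Rightarrow> bool" where
  "pseudo_riemannian_manifold A g \<longleftrightarrow> smooth_atlas A \<and> pseudo_riemannian_metric A g"

text \<open>Derivative in the direction \<open>z\<close> of the component \<open>g(v, w)\<close>, for constant \<open>v\<close> and \<open>w\<close>.\<close>

definition metric_deriv ::
  "('a, 'e::euclidean_space) metric \<Rightarrow> ('a, 'e) chart \<Rightarrow> 'a \<Rightarrow> 'e \<Rightarrow> 'e \<Rightarrow> 'e \<Rightarrow> real" where
  "metric_deriv g c p z v w =
     frechet_derivative (\<lambda>x. g c (chart_inv c x) v w) (at (chart_map c p)) z"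

text \<open>Christoffel symbols \<open>\<Gamma>\<^sup>k\<^sub>i\<^sub>j v\<^sup>i w\<^sup>j e\<^sub>k\<close> of the Levi-Civita connection.\<close>

definition christoffel ::
  "('a, 'e::euclidean_space) metric \<Rightarrow> ('a, 'e) chart \<Rightarrow> 'a \<Rightarrow> 'e \<Rightarrow> 'e \<Rightarrow> 'e" where
  "christoffel g c p v w =
     sharp (g c p)
       (\<lambda>z. (metric_deriv g c p v w z + metric_deriv g c p w v z - metric_deriv g c p z v w) / 2)"

definition covariant_derivative ::
  "('a, 'e::euclidean_space) metric \<Rightarrow> ('a, 'e) vfield \<Rightarrow> ('a, 'e) chart \<Rightarrow> 'a \<Rightarrow> 'e \<Rightarrow> 'e" where
  "covariant_derivative g X c p v =
     frechet_derivative (X c \<circ> chart_inv c) (at (chart_map c p)) v + christoffel g c p v (X c p)"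

definition divergence ::
  "('a, 'e::euclidean_space) chart set \<Rightarrow> ('a, 'e) metric \<Rightarrow> ('a, 'e) vfield \<Rightarrow> 'a \<Rightarrow> real" where
  "divergence A g X p =
     (\<Sum>b\<in>Basis. covariant_derivative g X (chart_at A p) p b \<bullet> b)"

definition gradient ::
  "('a, 'e::euclidean_space) metric \<Rightarrow> ('a \<Rightarrow> real) \<Rightarrow> ('a, 'e) vfield" where
  "gradient g u c p = sharp (g c p) (frechet_derivative (u \<circ> chart_inv c) (at (chart_map c p)))"

text \<open>\<open>|X|\<^sup>2 = g(X, X)\<close>, possibly negative.\<close>

definition norm_sq ::
  "('a, 'e) chart set \<Rightarrow> ('a, 'e) metric \<Rightarrow> ('a, 'e) vfield \<Rightarrow> 'a \<Rightarrow> real" where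
  "norm_sq A g X p = (let c = chart_at A p in g c p (X c p) (X c p))"

section \<open>Submanifold geometry\<close>

text \<open>\<open>F\<close> maps a manifold with charts \<open>c\<close> to a pseudo-Riemannian manifold with charts \<open>d\<close> and
  metric \<open>h\<close>. Vectors at \<open>F p\<close> are given by their components in \<open>d\<close>.\<close>

definition local_map ::
  "('a, 'e) chart \<Rightarrow> ('b, 'f) chart \<Rightarrow> ('a \<Rightarrow> 'b) \<Rightarrow> 'e \<Rightarrow> 'f" where
  "local_map c d F = chart_map d \<circ> F \<circ> chart_inv c"

definition pushforward ::
  "('a, 'e::euclidean_space) chart \<Rightarrow> ('b, 'f::euclidean_space) chart \<Rightarrow> ('a \<Rightarrow> 'b) \<Rightarrow> 'a \<Rightarrow> 'e \<Rightarrow> 'f"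
  where
  "pushforward c d F p = frechet_derivative (local_map c d F) (at (chart_map c p))"

definition induced_metric ::
  "('b, 'f::euclidean_space) metric \<Rightarrow> ('a, 'e::euclidean_space) chart \<Rightarrow> ('b, 'f) chart \<Rightarrow>
   ('a \<Rightarrow> 'b) \<Rightarrow> 'a \<Rightarrow> 'e \<Rightarrow> 'e \<Rightarrow> real" where
  "induced_metric h c d F p v w = h d (F p) (pushforward c d F p v) (pushforward c d F p w)"

definition nondegenerate_map ::
  "('a, 'e::euclidean_space) chart set \<Rightarrow> ('b, 'f::euclidean_space) chart set \<Rightarrow>
   ('b, 'f) metric \<Rightarrow> ('a \<Rightarrow> 'b) \<Rightarrow> bool" where
  "nondegenerate_map A A' h F \<longleftrightarrow>
     (\<forall>c\<in>A. \<forall>d\<in>A'. \<forall>p\<in>chart_dom c. F p \<in> chart_dom d \<longrightarrow>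
        nondegenerate (induced_metric h c d F p))"

definition normal_part ::
  "('b, 'f::euclidean_space) metric \<Rightarrow> ('a, 'e::euclidean_space) chart \<Rightarrow> ('b, 'f) chart \<Rightarrow>
   ('a \<Rightarrow> 'b) \<Rightarrow> 'a \<Rightarrow> 'f \<Rightarrow> 'f" where
  "normal_part h c d F p = normal_component (h d (F p)) (pushforward c d F p)"

text \<open>\<open>II(v, w)\<close> is the normal part of the ambient covariant derivative, in the direction
  \<open>dF v\<close>, of the field \<open>dF w\<close> along \<open>F\<close>, where \<open>w\<close> is extended by constant components in \<open>c\<close>.\<close>

definition second_fundamental_form ::
  "('b, 'f::euclidean_space) metric \<Rightarrow> ('a, 'e::euclidean_space) chart \<Rightarrow> ('b, 'f) chart \<Rightarrow>
   ('a \<Rightarrow> 'b) \<Rightarrow> 'a \<Rightarrow> 'e \<Rightarrow> 'e \<Rightarrow> 'f" where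
  "second_fundamental_form h c d F p v w =
     normal_part h c d F p
       (frechet_derivative (\<lambda>x. frechet_derivative (local_map c d F) (at x) w)
          (at (chart_map c p)) v
        + christoffel h d (F p) (pushforward c d F p v) (pushforward c d F p w))"

definition mean_curvature_vector ::
  "('b, 'f::euclidean_space) metric \<Rightarrow> ('a, 'e::euclidean_space) chart \<Rightarrow> ('b, 'f) chart \<Rightarrow>
   ('a \<Rightarrow> 'b) \<Rightarrow> 'a \<Rightarrow> 'f" where
  "mean_curvature_vector h c d F p =
     trace_wrt (induced_metric h c d F p) (second_fundamental_form h c d F p)"

text \<open>The number \<open>H\<close> with \<open>mean curvature vector = \<epsilon> H \<nu>\<close>, an equation between tangent vectors
  at \<open>F p\<close>; \<open>\<nu> d p\<close> are the components of the normal at \<open>F p\<close>.\<close>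

definition mean_curvature ::
  "('a, 'e::euclidean_space) chart set \<Rightarrow> ('b, 'f::euclidean_space) chart set \<Rightarrow>
   ('b, 'f) metric \<Rightarrow> ('a \<Rightarrow> 'b) \<Rightarrow> real \<Rightarrow> (('b, 'f) chart \<Rightarrow> 'a \<Rightarrow> 'f) \<Rightarrow> 'a \<Rightarrow> real" where
  "mean_curvature A A' h F \<epsilon> \<nu> p =
     (THE H. \<forall>c\<in>A. \<forall>d\<in>A'. p \<in> chart_dom c \<longrightarrow> F p \<in> chart_dom d \<longrightarrow>
        mean_curvature_vector h c d F p = (\<epsilon> * H) *\<^sub>R \<nu> d p)"

section \<open>The product with a line, and graphs\<close>

definition product_chart :: "('a, 'e) chart \<Rightarrow> ('a \<times> real, 'e \<times> real) chart" where
  "product_chart c = (chart_dom c \<times> UNIV, map_prod (chart_map c) id)"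

definition product_charts :: "('a, 'e) chart set \<Rightarrow> ('a \<times> real, 'e \<times> real) chart set" where
  "product_charts A = product_chart ` A"

definition base_chart :: "('a \<times> real, 'e \<times> real) chart \<Rightarrow> ('a, 'e) chart" where
  "base_chart d = (fst ` chart_dom d, \<lambda>p. fst (chart_map d (p, 0)))"

lemma base_chart_product_chart [simp]: "base_chart (product_chart c) = c"
  by (simp add: base_chart_def product_chart_def fst_image_times)

text \<open>\<open>g + \<epsilon>' dt\<^sup>2\<close>\<close>

definition product_metric ::
  "real \<Rightarrow> ('a, 'e) metric \<Rightarrow> ('a \<times> real, 'e \<times> real) metric" where
  "product_metric \<epsilon>' g d q v w =
     g (base_chart d) (fst q) (fst v) (fst w) + \<epsilon>' * (snd v * snd w)"

text \<open>In every product chart \<open>\<partial>\<^sub>t\<close> has the components \<open>(0, 1)\<close>.\<close>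

definition translating_soliton ::
  "('b, 'f::euclidean_space) chart set \<Rightarrow> ('a, 'e::euclidean_space) chart set \<Rightarrow>
   ('a, 'e) metric \<Rightarrow> real \<Rightarrow> ('b \<Rightarrow> 'a \<times> real) \<Rightarrow> bool" where
  "translating_soliton B A g \<epsilon>' F \<longleftrightarrow>
     (\<forall>c\<in>B. \<forall>d\<in>product_charts A. \<forall>p\<in>chart_dom c. F p \<in> chart_dom d \<longrightarrow>
        mean_curvature_vector (product_metric \<epsilon>' g) c d F p =
          normal_part (product_metric \<epsilon>' g) c d F p (0, 1))"

definition graph_map :: "('a \<Rightarrow> real) \<Rightarrow> 'a \<Rightarrow> 'a \<times> real" where
  "graph_map u p = (p, u p)"

definition graph_W ::
  "('a, 'e::euclidean_space) chart set \<Rightarrow> ('a, 'e) metric \<Rightarrow> real \<Rightarrow> real \<Rightarrow> ('a \<Rightarrow> real) \<Rightarrow>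
   'a \<Rightarrow> real" where
  "graph_W A g \<epsilon>' \<epsilon> u p = sqrt (\<epsilon> * (\<epsilon>' + norm_sq A g (gradient g u) p))"

definition upward_normal ::
  "('a, 'e::euclidean_space) chart set \<Rightarrow> ('a, 'e) metric \<Rightarrow> real \<Rightarrow> real \<Rightarrow> ('a \<Rightarrow> real) \<Rightarrow>
   ('a \<times> real, 'e \<times> real) chart \<Rightarrow> 'a \<Rightarrow> 'e \<times> real" where
  "upward_normal A g \<epsilon>' \<epsilon> u d p =
     (1 / graph_W A g \<epsilon>' \<epsilon> u p) *\<^sub>R (- \<epsilon>' *\<^sub>R gradient g u (base_chart d) p, 1)"

text \<open>Since the product of \<open>\<partial>\<^sub>t\<close> with the upward normal is \<open>\<epsilon>' / W\<close>, a graph that is a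
  translating soliton has \<open>H = \<epsilon>' / W\<close>: for \<open>\<epsilon>' = -1\<close> this \<open>H\<close> is negative.\<close>

definition graph_mean_curvature ::
  "('a, 'e::euclidean_space) chart set \<Rightarrow> ('a, 'e) metric \<Rightarrow> real \<Rightarrow> real \<Rightarrow> ('a \<Rightarrow> real) \<Rightarrow>
   'a \<Rightarrow> real" where
  "graph_mean_curvature A g \<epsilon>' \<epsilon> u =
     mean_curvature A (product_charts A) (product_metric \<epsilon>' g) (graph_map u) \<epsilon>
       (upward_normal A g \<epsilon>' \<epsilon> u)"

end

theory Submission
  imports Defs
begin

text \<open>
  The field \<open>dF w\<close> along the graph has components \<open>(d\<tau> w, du w)\<close>, where \<open>\<tau>\<close> is the transition
  from the chart of the domain to that of the target. Its ambient covariant derivative splits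
  as \<open>dF(\<Gamma>(v, w)) + Hess u(v, w) \<partial>\<^sub>t\<close>, because the Christoffel symbols of \<open>g + \<epsilon>' dt\<^sup>2\<close> are those
  of \<open>g\<close>. Tangential terms vanish under the normal projection, so \<open>II = Hess u \<cdot> N\<close> with \<open>N\<close> the
  normal part of \<open>\<partial>\<^sub>t\<close>, and the mean curvature vector is \<open>L N\<close> with \<open>L = tr\<^sub>\<gamma> Hess u\<close>. As
  \<open>N = (\<epsilon> \<epsilon>' / W) \<nu>\<close> never vanishes, the soliton equation \<open>L N = N\<close> says \<open>L = 1\<close>, and the mean
  curvature function is \<open>H = \<epsilon>' L / W\<close>.

  It remains to see \<open>L\<close> in the divergence. One has \<open>\<nabla>\<^sub>v \<nabla>u = Hess u(v, \<cdot>)\<close> with its index raised by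
  \<open>g\<close>, and \<open>d(W\<^sup>2)(v) = 2 \<epsilon> Hess u(v, \<nabla>u)\<close>. Hence \<open>div(\<nabla>u / W)\<close> is
  \<open>(\<Delta>u - \<epsilon> Hess u(\<nabla>u, \<nabla>u) / W\<^sup>2) / W\<close>. The induced metric \<open>\<gamma> = g + \<epsilon>' du \<otimes> du\<close> is a rank one
  perturbation of \<open>g\<close>, with inverse \<open>g\<^sup>-\<^sup>1 - \<epsilon> \<nabla>u \<otimes> \<nabla>u / W\<^sup>2\<close>; so the bracket is exactly \<open>L\<close>, and
  \<open>div(\<nabla>u / W) = L / W\<close>. All the equations of the theorem therefore reduce to \<open>L = 1\<close>.

  Two points need work. The divergence and \<open>|\<nabla>u|\<^sup>2\<close> are evaluated in chosen charts, and the second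
  fundamental form in an arbitrary pair of charts, so \<open>L\<close> has to be independent of the chart. This
  rests on the transformation law of the Christoffel symbols (\<open>christoffel_transition\<close>), which
  needs the symmetry of second derivatives of transition maps (\<open>second_derivative_symmetric\<close>),
  and on the invariance of traces under conjugation (\<open>endo_trace_conjugate\<close>). Moreover, the
  gradient is defined by solving a linear system; \<open>differentiable_sharp\<close> shows that the solution
  depends differentiably on the base point. The lemmas \<open>normal_part_graph\<close>, \<open>trace_hessian\<close> and
  \<open>divergence_graph\<close> then carry out the computation above.
\<close>

section \<open>Nondegenerate bilinear forms and traces\<close>

lemma sharp_eqI:
  assumes "nondegenerate B" "bilinear B" "\<And>v. B z v = \<alpha> v"
  shows "sharp B \<alpha> = z"
  unfolding sharp_def
proof (rule the_equality)
  show "\<forall>v. B z v = \<alpha> v" using assms(3) by blast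
next
  fix y assume "\<forall>v. B y v = \<alpha> v"
  then have "\<forall>v. B (y - z) v = 0"
    using assms by (simp add: bilinear_lsub)
  then show "y = z" using assms(1) unfolding nondegenerate_def by force
qed

lemma bilinear_eq_on_Basis:
  assumes "bilinear B" "linear \<alpha>" "\<And>b. b \<in> Basis \<Longrightarrow> B z b = (\<alpha> b :: real)"
  shows "B z v = \<alpha> v"
proof (rule linear_eq_on[of "B z" \<alpha> v Basis])
  show "linear (B z)" using assms(1) by (simp add: bilinear_def)
qed (use assms in auto)

lemma linear_bilinear_components:
  assumes "bilinear B"
  shows "linear (\<lambda>z. \<Sum>b\<in>Basis. (B z b :: real) *\<^sub>R (b :: 'e::euclidean_space))"
  by (rule linearI) (simp_all add: bilinear_ladd[OF assms] bilinear_lmul[OF assms]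
      algebra_simps sum.distrib scaleR_sum_right)

text \<open>This map is \<open>z \<mapsto> B(z, \<cdot>)\<close> read in the standard basis. In finite dimension its injectivity makes
  it onto, which is why every covector has a preimage under the musical isomorphism.\<close>

lemma inj_bilinear_components:
  assumes "bilinear B" "nondegenerate B"
  shows "inj (\<lambda>z. \<Sum>b\<in>Basis. (B z b :: real) *\<^sub>R (b :: 'e::euclidean_space))"
proof -
  have "z = 0" if "(\<Sum>b\<in>Basis. B z b *\<^sub>R b) = 0" for z
  proof -
    have "B z b = 0" if "b \<in> Basis" for b
      using arg_cong[OF \<open>(\<Sum>b\<in>Basis. B z b *\<^sub>R b) = 0\<close>, of "\<lambda>x. x \<bullet> b"] that
      by (simp add: inner_sum_left inner_Basis if_distrib cong: if_cong)
    then have "\<forall>v. B z v = 0"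
      using bilinear_eq_on_Basis[OF assms(1), of "\<lambda>_. 0" z] by (simp add: linear_iff)
    then show ?thesis using assms(2) unfolding nondegenerate_def by blast
  qed
  then show ?thesis
    using linear_injective_0[OF linear_bilinear_components[OF assms(1)]] by blast
qed

text \<open>The description in \<open>sharp\<close> denotes: some \<open>z\<close> represents \<open>\<alpha>\<close> because the injective map above is
  surjective, and nondegeneracy makes it unique.\<close>

lemma sharp_works:
  assumes "bilinear B" "nondegenerate B" "linear \<alpha>"
  shows "B (sharp B \<alpha>) v = \<alpha> v"
proof -
  obtain z where z: "(\<Sum>b\<in>Basis. B z b *\<^sub>R b) = (\<Sum>b\<in>Basis. \<alpha> b *\<^sub>R b)"
    using surjD[OF linear_injective_imp_surjective[OF linear_bilinear_components[OF assms(1)]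
        inj_bilinear_components[OF assms(1,2)]], of "\<Sum>b\<in>Basis. \<alpha> b *\<^sub>R b"] by metis
  have "B z b = \<alpha> b" if "b \<in> Basis" for b
    using arg_cong[OF z, of "\<lambda>x. x \<bullet> b"] that
    by (simp add: inner_sum_left inner_Basis if_distrib cong: if_cong)
  then have "B z v = \<alpha> v" for v
    using bilinear_eq_on_Basis[OF assms(1,3)] by blast
  then show ?thesis using sharp_eqI[OF assms(2,1), of z \<alpha>] by simp
qed

lemma linear_sharp:
  assumes "bilinear B" "nondegenerate B" "bilinear Q"
  shows "linear (\<lambda>v. sharp B (Q v))"
proof (rule linearI)
  have Q: "linear (Q v)" for v using assms(3) by (simp add: bilinear_def)
  note w = sharp_works[OF assms(1,2) Q]
  show "sharp B (Q (x + y)) = sharp B (Q x) + sharp B (Q y)" for x y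
    by (rule sharp_eqI[OF assms(2,1)])
      (simp add: bilinear_ladd[OF assms(1)] bilinear_ladd[OF assms(3)] w)
  show "sharp B (Q (r *\<^sub>R x)) = r *\<^sub>R sharp B (Q x)" for r x
    by (rule sharp_eqI[OF assms(2,1)])
      (simp add: bilinear_lmul[OF assms(1)] bilinear_lmul[OF assms(3)] w)
qed

text \<open>Traces of bilinear forms, and the divergence, are reduced to the trace of an endomorphism, for
  which the behaviour under a change of chart is conjugation.\<close>

definition endo_trace :: "('e::euclidean_space \<Rightarrow> 'e) \<Rightarrow> real" where
  "endo_trace f = (\<Sum>b\<in>Basis. f b \<bullet> b)"

lemma endo_trace_add: "endo_trace (\<lambda>v. f v + h v) = endo_trace f + endo_trace h"
  by (simp add: endo_trace_def inner_add_left sum.distrib)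

lemma endo_trace_scaleR: "endo_trace (\<lambda>v. r *\<^sub>R f v) = r * endo_trace f"
  by (simp add: endo_trace_def sum_distrib_left)

lemma endo_trace_rank_one:
  fixes \<alpha> :: "'e::euclidean_space \<Rightarrow> real"
  assumes "linear \<alpha>"
  shows "endo_trace (\<lambda>v. \<alpha> v *\<^sub>R z) = \<alpha> z"
proof -
  have "\<alpha> z = \<alpha> (\<Sum>b\<in>Basis. (z \<bullet> b) *\<^sub>R b)" by (simp add: euclidean_representation)
  also have "\<dots> = (\<Sum>b\<in>Basis. (z \<bullet> b) * \<alpha> b)"
    using assms by (simp add: linear_sum linear_cmul)
  finally show ?thesis by (simp add: endo_trace_def mult.commute)
qed

lemma endo_trace_comp_commute:
  fixes f :: "'e::euclidean_space \<Rightarrow> 'e" and h :: "'e \<Rightarrow> 'e"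
  assumes "linear f" "linear h"
  shows "endo_trace (f \<circ> h) = endo_trace (h \<circ> f)"
proof -
  have expand: "k z \<bullet> b = (\<Sum>i\<in>Basis. (z \<bullet> i) * (k i \<bullet> b))" if "linear k"
    for k :: "'e \<Rightarrow> 'e" and z b
  proof -
    have "k z = k (\<Sum>b\<in>Basis. (z \<bullet> b) *\<^sub>R b)" by (simp add: euclidean_representation)
    also have "\<dots> = (\<Sum>b\<in>Basis. (z \<bullet> b) *\<^sub>R k b)"
      using that by (simp add: linear_sum linear_cmul)
    finally show ?thesis by (simp add: inner_sum_left)
  qed
  have "endo_trace (f \<circ> h) = (\<Sum>b\<in>Basis. \<Sum>i\<in>Basis. (h b \<bullet> i) * (f i \<bullet> b))"
    unfolding endo_trace_def o_def by (subst expand[OF assms(1)]) simp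
  also have "\<dots> = (\<Sum>i\<in>Basis. \<Sum>b\<in>Basis. (f i \<bullet> b) * (h b \<bullet> i))"
    by (subst sum.swap) (simp add: mult.commute)
  also have "\<dots> = endo_trace (h \<circ> f)"
    unfolding endo_trace_def o_def by (subst (2) expand[OF assms(2)]) simp
  finally show ?thesis .
qed

text \<open>As \<open>S = K T L\<close>, the claim is \<open>tr(K (T L)) = tr((T L) K)\<close>. In finite dimension \<open>K L = id\<close>
  forces \<open>L K = id\<close>.\<close>

lemma endo_trace_conjugate:
  fixes L K S T :: "'e::euclidean_space \<Rightarrow> 'e"
  assumes "linear L" "linear K" "linear T" and KL: "\<And>v. K (L v) = v"
    and conj: "\<And>v. L (S v) = T (L v)"
  shows "endo_trace S = endo_trace T"
proof -
  have LK: "L (K v) = v" for v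
    using linear_inverse_left[OF assms(1,2)] KL by (simp add: fun_eq_iff)
  have "S = K \<circ> (T \<circ> L)"
    by (rule ext) (simp add: conj[symmetric] KL)
  moreover have "(T \<circ> L) \<circ> K = T" using LK by (simp add: fun_eq_iff)
  moreover have "linear (T \<circ> L)" using assms by (simp add: linear_compose)
  ultimately show ?thesis using endo_trace_comp_commute[OF assms(2), of "T \<circ> L"] by simp
qed

text \<open>Raising an index of \<open>Q\<close> gives the endomorphism \<open>v \<mapsto> sharp B (Q v)\<close>. Its diagonal entries are the
  summands of \<open>trace_wrt\<close>, by the symmetry of \<open>B\<close>.\<close>

lemma trace_wrt_bilinear:
  assumes "bilinear B" "nondegenerate B" "\<And>v w. B v w = B w v" "bilinear Q"
  shows "trace_wrt B (\<lambda>v w. Q v w *\<^sub>R N) = endo_trace (\<lambda>v. sharp B (Q v)) *\<^sub>R N"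
proof -
  have "Q b (sharp B (\<lambda>v. b \<bullet> v)) = sharp B (Q b) \<bullet> b" for b
  proof -
    have "Q b (sharp B (\<lambda>v. b \<bullet> v)) = B (sharp B (Q b)) (sharp B (\<lambda>v. b \<bullet> v))"
      using assms by (subst sharp_works) (auto simp: bilinear_def)
    also have "\<dots> = B (sharp B (\<lambda>v. b \<bullet> v)) (sharp B (Q b))" by (rule assms(3))
    also have "\<dots> = b \<bullet> sharp B (Q b)"
      by (rule sharp_works[OF assms(1,2)]) (simp add: bounded_linear.linear bounded_linear_inner_right)
    finally show ?thesis by (simp add: inner_commute)
  qed
  then show ?thesis by (simp add: trace_wrt_def endo_trace_def scaleR_sum_left)
qed

text \<open>Two candidates for the normal part differ by a vector in the range of \<open>D\<close> that is orthogonal to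
  that range; it vanishes because the induced form is nondegenerate.\<close>

lemma normal_component_eqI:
  assumes "bilinear h" "linear D" "nondegenerate (\<lambda>v w. h (D v) (D w))"
    and n: "\<And>v. h n (D v) = 0" and w: "w = n + D z"
  shows "normal_component h D w = n"
  unfolding normal_component_def
proof (rule the_equality)
  show "(\<forall>v. h n (D v) = 0) \<and> (\<exists>v. w = n + D v)" using n w by blast
next
  fix m assume m: "(\<forall>v. h m (D v) = 0) \<and> (\<exists>v. w = m + D v)"
  then obtain y where "w = m + D y" by blast
  with w have nm: "n - m = D (y - z)" using assms(2) by (simp add: linear_diff algebra_simps)
  have "\<forall>v. h (D (y - z)) (D v) = 0"
    unfolding nm[symmetric] using m n by (simp add: bilinear_lsub[OF assms(1)])
  then have "y - z = 0" using assms(3) unfolding nondegenerate_def by blast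
  with nm show "m = n" using assms(2) by (simp add: linear_0)
qed

section \<open>Derivatives of families of forms, and second derivatives\<close>

lemma differentiable_transform_within_open:
  assumes "f differentiable (at x)" "open S" "x \<in> S" "\<And>y. y \<in> S \<Longrightarrow> f y = g y"
  shows "g differentiable (at x)"
proof -
  obtain f' where "(f has_derivative f') (at x)" using assms(1) unfolding differentiable_def by blast
  then have "(g has_derivative f') (at x)"
    by (rule has_derivative_transform_within_open[OF _ assms(2-4)])
  then show ?thesis unfolding differentiable_def by blast
qed

text \<open>The increment of a differentiable factor that vanishes at \<open>p\<close> is \<open>O(|x - p|)\<close>, so multiplying it
  by something that tends to \<open>0\<close> leaves \<open>o(|x - p|)\<close>. In
  \<open>differentiable_sharp\<close> the factor \<open>y\<close> is one whose differentiability is still to be shown.\<close>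

lemma has_derivative_vanishing_product:
  fixes a :: "'x::real_normed_vector \<Rightarrow> real"
  assumes a: "(a has_derivative a') (at p)" "a p = 0" and y: "(y \<longlongrightarrow> 0) (at p)" "y p = (0::real)"
  shows "((\<lambda>x. y x * a x) has_derivative (\<lambda>h. 0)) (at p)"
proof -
  obtain K where K: "K > 0" "\<And>h. \<bar>a' h\<bar> \<le> norm h * K"
    using bounded_linear.pos_bounded[OF has_derivative_bounded_linear[OF a(1)]] by auto
  show ?thesis
    unfolding has_derivative_at_alt
  proof (intro conjI allI impI)
    fix e :: real assume e: "0 < e"
    obtain d1 where d1: "d1 > 0" "\<And>x. norm (x - p) < d1 \<Longrightarrow> \<bar>a x - a' (x - p)\<bar> \<le> 1 * norm (x - p)"
      using a(1)[unfolded has_derivative_at_alt, THEN conjunct2, rule_format, of 1] a(2) by auto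
    have "e / (K + 1) > 0" using e K by simp
    then obtain d2 where d2: "d2 > 0" "\<And>x. x \<noteq> p \<Longrightarrow> norm (x - p) < d2 \<Longrightarrow> \<bar>y x\<bar> < e / (K + 1)"
      using y unfolding tendsto_iff eventually_at by (auto simp: dist_norm)
    have "norm (y x * a x - y p * a p - 0) \<le> e * norm (x - p)" if x: "norm (x - p) < min d1 d2" for x
    proof -
      have "\<bar>a x\<bar> \<le> (K + 1) * norm (x - p)"
        using d1(2)[of x] K(2)[of "x - p"] x by (simp add: algebra_simps)
      moreover have "\<bar>y x\<bar> \<le> e / (K + 1)"
        using d2(2)[of x] x y(2) e K by (cases "x = p") auto
      ultimately have "\<bar>y x\<bar> * \<bar>a x\<bar> \<le> e / (K + 1) * ((K + 1) * norm (x - p))"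
        using e K by (intro mult_mono) auto
      then show ?thesis using K(1) a(2) y(2) by (simp add: abs_mult)
    qed
    then show "\<exists>d>0. \<forall>x. norm (x - p) < d \<longrightarrow> norm (y x * a x - y p * a p - 0) \<le> e * norm (x - p)"
      using d1(1) d2(1) by (intro exI[of _ "min d1 d2"]) auto
  qed simp
qed

lemma bilinear_expand:
  fixes B :: "'e::euclidean_space \<Rightarrow> 'f::euclidean_space \<Rightarrow> real"
  assumes "bilinear B"
  shows "B v w = (\<Sum>i\<in>Basis. \<Sum>j\<in>Basis. (v \<bullet> i) * (w \<bullet> j) * B i j)"
proof -
  have "B v w = B (\<Sum>i\<in>Basis. (v \<bullet> i) *\<^sub>R i) (\<Sum>j\<in>Basis. (w \<bullet> j) *\<^sub>R j)"
    by (simp add: euclidean_representation)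
  also have "\<dots> = (\<Sum>i\<in>Basis. \<Sum>j\<in>Basis. (v \<bullet> i) * (w \<bullet> j) * B i j)"
    by (simp add: bilinear_sum[OF assms] sum.cartesian_product bilinear_lmul[OF assms]
        bilinear_rmul[OF assms] mult_ac)
  finally show ?thesis .
qed

lemma bilinear_derivative_of_family:
  fixes B :: "'x::real_normed_vector \<Rightarrow> 'e::real_vector \<Rightarrow> 'f::real_vector \<Rightarrow> real"
  assumes S: "open S" "p \<in> S" and B: "\<And>x. x \<in> S \<Longrightarrow> bilinear (B x)"
    and B': "\<And>v w. ((\<lambda>x. B x v w) has_derivative B' v w) (at p)"
  shows "bilinear (\<lambda>v w. B' v w h)"
  unfolding bilinear_def
proof (intro conjI allI linearI)
  note uniq = has_derivative_unique[OF B' has_derivative_transform_within_open[OF _ S], THEN fun_cong]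
  show "B' v (w + w') h = B' v w h + B' v w' h" for v w w'
    by (rule uniq, rule has_derivative_add[OF B' B']) (simp add: bilinear_radd[OF B])
  show "B' v (r *\<^sub>R w) h = r *\<^sub>R B' v w h" for v w r
    by (rule uniq, rule has_derivative_scaleR_right[OF B']) (simp add: bilinear_rmul[OF B])
  show "B' (v + v') w h = B' v w h + B' v' w h" for v v' w
    by (rule uniq, rule has_derivative_add[OF B' B']) (simp add: bilinear_ladd[OF B])
  show "B' (r *\<^sub>R v) w h = r *\<^sub>R B' v w h" for v w r
    by (rule uniq, rule has_derivative_scaleR_right[OF B']) (simp add: bilinear_lmul[OF B])
qed

text \<open>The hypothesis on \<open>B\<close> concerns constant arguments, as for the components of a metric. Expanding
  \<open>B\<^sub>x(X(x), Y(x))\<close> in the standard bases reduces the claim to the product rule for real functions.\<close>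

lemma has_derivative_bilinear_family:
  fixes B :: "'x::real_normed_vector \<Rightarrow> 'e::euclidean_space \<Rightarrow> 'f::euclidean_space \<Rightarrow> real"
  assumes S: "open S" "p \<in> S" and B: "\<And>x. x \<in> S \<Longrightarrow> bilinear (B x)"
    and B': "\<And>v w. ((\<lambda>x. B x v w) has_derivative B' v w) (at p)"
    and X: "(X has_derivative X') (at p)" and Y: "(Y has_derivative Y') (at p)"
  shows "((\<lambda>x. B x (X x) (Y x)) has_derivative
    (\<lambda>h. B' (X p) (Y p) h + B p (X' h) (Y p) + B p (X p) (Y' h))) (at p)"
proof (rule has_derivative_transform_within_open[OF _ S])
  have "((\<lambda>x. \<Sum>i\<in>Basis. \<Sum>j\<in>Basis. (X x \<bullet> i) * (Y x \<bullet> j) * B x i j) has_derivative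
     (\<lambda>h. \<Sum>i\<in>Basis. \<Sum>j\<in>Basis. (X p \<bullet> i) * (Y p \<bullet> j) * B' i j h +
        ((X p \<bullet> i) * (Y' h \<bullet> j) + (X' h \<bullet> i) * (Y p \<bullet> j)) * B p i j)) (at p)"
    by (intro has_derivative_sum has_derivative_mult has_derivative_inner_left X Y B')
  moreover have "(\<Sum>i\<in>Basis. \<Sum>j\<in>Basis. (X p \<bullet> i) * (Y p \<bullet> j) * B' i j h +
        ((X p \<bullet> i) * (Y' h \<bullet> j) + (X' h \<bullet> i) * (Y p \<bullet> j)) * B p i j)
     = B' (X p) (Y p) h + B p (X' h) (Y p) + B p (X p) (Y' h)" for h
    using bilinear_expand[OF bilinear_derivative_of_family[OF S B B'], of "X p" "Y p" h]
    unfolding bilinear_expand[OF B[OF S(2)], of "X' h" "Y p"] bilinear_expand[OF B[OF S(2)], of "X p" "Y' h"]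
    by (simp add: sum.distrib algebra_simps)
  ultimately show "((\<lambda>x. \<Sum>i\<in>Basis. \<Sum>j\<in>Basis. (X x \<bullet> i) * (Y x \<bullet> j) * B x i j) has_derivative
     (\<lambda>h. B' (X p) (Y p) h + B p (X' h) (Y p) + B p (X p) (Y' h))) (at p)"
    by simp
  fix x assume "x \<in> S"
  then show "(\<Sum>i\<in>Basis. \<Sum>j\<in>Basis. (X x \<bullet> i) * (Y x \<bullet> j) * B x i j) = B x (X x) (Y x)"
    by (rule bilinear_expand[OF B, symmetric])
qed

text \<open>Obtained from the bilinear case by viewing the covector \<open>\<alpha>\<close> as the form \<open>(r, v) \<mapsto> r \<alpha>(v)\<close> with
  \<open>r\<close> real, evaluated at \<open>r = 1\<close>.\<close>

lemma has_derivative_linear_family: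
  fixes \<alpha> :: "'x::real_normed_vector \<Rightarrow> 'e::euclidean_space \<Rightarrow> real"
  assumes S: "open S" "p \<in> S" and \<alpha>: "\<And>x. x \<in> S \<Longrightarrow> linear (\<alpha> x)"
    and \<alpha>': "\<And>v. ((\<lambda>x. \<alpha> x v) has_derivative \<alpha>' v) (at p)"
    and Y: "(Y has_derivative Y') (at p)"
  shows "((\<lambda>x. \<alpha> x (Y x)) has_derivative (\<lambda>h. \<alpha>' (Y p) h + \<alpha> p (Y' h))) (at p)"
proof -
  have "bilinear (\<lambda>r v. (r::real) * \<alpha> x v)" if "x \<in> S" for x
    using \<alpha>[OF that] by (simp add: bilinear_def linear_iff algebra_simps)
  from has_derivative_bilinear_family[OF S this has_derivative_mult_right[OF \<alpha>'] has_derivative_const Y, of 1]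
  show ?thesis by simp
qed

text \<open>Write \<open>X(x)\<close> for the solution, \<open>y(x) = X(x) - X(p)\<close> and \<open>L = B\<^sub>p\<close>. Subtracting the equations at
  \<open>x\<close> and at \<open>p\<close> gives \<open>L y(x) = \<beta>(x) - E\<^sub>x y(x)\<close>, where \<open>\<beta>\<close> is differentiable with \<open>\<beta>(p) = 0\<close> and
  \<open>E\<^sub>x = B\<^sub>x - B\<^sub>p\<close> tends to \<open>0\<close>. Near \<open>p\<close> the term with \<open>E\<^sub>x\<close> is absorbed, so \<open>y = O(|\<beta>|)\<close> tends to
  \<open>0\<close>. Then \<open>E\<^sub>x y(x)\<close> is a sum of vanishing products, hence differentiable at \<open>p\<close>, and so is
  \<open>y = L\<^sup>-\<^sup>1(\<beta> - E y)\<close>.\<close>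

lemma differentiable_sharp:
  fixes B :: "'x::real_normed_vector \<Rightarrow> 'e::euclidean_space \<Rightarrow> 'e \<Rightarrow> real"
  assumes S: "open S" "p \<in> S"
    and B: "\<And>x. x \<in> S \<Longrightarrow> bilinear (B x)" "\<And>x. x \<in> S \<Longrightarrow> nondegenerate (B x)"
    and \<alpha>: "\<And>x. x \<in> S \<Longrightarrow> linear (\<alpha> x)"
    and dB: "\<And>v w. (\<lambda>x. B x v w) differentiable (at p)"
    and d\<alpha>: "\<And>v. (\<lambda>x. \<alpha> x v) differentiable (at p)"
  shows "(\<lambda>x. sharp (B x) (\<alpha> x)) differentiable (at p)"
proof -
  define X where "X x = sharp (B x) (\<alpha> x)" for x
  define y where "y x = X x - X p" for x
  define L where "L z = (\<Sum>b\<in>Basis. B p z b *\<^sub>R b)" for z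
  define \<beta> where "\<beta> x = (\<Sum>b\<in>Basis. (\<alpha> x b - B x (X p) b) *\<^sub>R b)" for x
  define E where "E x z = (\<Sum>b\<in>Basis. (B x z b - B p z b) *\<^sub>R b)" for x z
  define e where "e x = (\<Sum>b\<in>Basis. \<Sum>i\<in>Basis. \<bar>B x i b - B p i b\<bar>)" for x
  have BX: "B x (X x) v = \<alpha> x v" if "x \<in> S" for x v
    unfolding X_def by (rule sharp_works[OF B(1) B(2) \<alpha>]) (use that in auto)
  have L: "linear L" "inj L"
    unfolding L_def using linear_bilinear_components inj_bilinear_components B S(2) by blast+
  then obtain K where K: "linear K" "K \<circ> L = id" using linear_injective_left_inverse by blast
  have Ly: "L (y x) = \<beta> x - E x (y x)" if "x \<in> S" for x
    unfolding L_def \<beta>_def E_def sum_subtractf[symmetric]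
    by (rule sum.cong) (simp_all add: y_def bilinear_lsub[OF B(1)] that S(2) BX algebra_simps)
  have y_eq: "y x = K (\<beta> x) - K (E x (y x))" if "x \<in> S" for x
  proof -
    have "y x = K (L (y x))" using fun_cong[OF K(2), of "y x"] by simp
    also have "\<dots> = K (\<beta> x - E x (y x))" using Ly[OF that] by simp
    finally show ?thesis using K(1) by (simp only: linear_diff)
  qed
  have E_expand: "E x z = (\<Sum>b\<in>Basis. (\<Sum>i\<in>Basis. (z \<bullet> i) * (B x i b - B p i b)) *\<^sub>R b)"
    if "x \<in> S" for x z
  proof -
    have "B q z b = (\<Sum>i\<in>Basis. (z \<bullet> i) * B q i b)" if "q \<in> S" for q b
    proof -
      have "linear (\<lambda>z. B q z b)" using B(1)[OF that] by (simp add: bilinear_def)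
      then have "B q (\<Sum>i\<in>Basis. (z \<bullet> i) *\<^sub>R i) b = (\<Sum>i\<in>Basis. (z \<bullet> i) * B q i b)"
        by (simp add: linear_sum[where f = "\<lambda>z. B q z b"] linear_cmul[where f = "\<lambda>z. B q z b"])
      then show ?thesis by (simp add: euclidean_representation)
    qed
    then show ?thesis
      using that S(2) by (simp add: E_def right_diff_distrib sum_subtractf)
  qed
  have E_bound: "norm (E x z) \<le> e x * norm z" if "x \<in> S" for x z
  proof -
    have "norm (E x z) \<le> (\<Sum>b\<in>Basis. \<bar>\<Sum>i\<in>Basis. (z \<bullet> i) * (B x i b - B p i b)\<bar>)"
      unfolding E_expand[OF that] by (rule order_trans[OF norm_sum]) simp
    also have "\<dots> \<le> (\<Sum>b\<in>Basis. \<Sum>i\<in>Basis. norm z * \<bar>B x i b - B p i b\<bar>)"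
      by (intro sum_mono order_trans[OF sum_abs])
        (auto simp: abs_mult intro!: mult_right_mono sum_mono Basis_le_norm)
    also have "\<dots> = e x * norm z"
      by (simp add: e_def sum_distrib_left sum_distrib_right mult.commute)
    finally show ?thesis .
  qed
  have isc: "((\<lambda>x. B x v w) \<longlongrightarrow> B p v w) (at p)" for v w
    using differentiable_imp_continuous_within[OF dB] by (simp add: continuous_within)
  have "(e \<longlongrightarrow> (\<Sum>b\<in>Basis. \<Sum>i\<in>(Basis::'e set). \<bar>B p i b - B p i b\<bar>)) (at p)"
    unfolding e_def by (intro tendsto_intros isc)
  then have e0: "(e \<longlongrightarrow> 0) (at p)" by simp
  have d\<beta>: "\<beta> differentiable (at p)"
    unfolding \<beta>_def by (intro differentiable_sum ballI finite_Basis differentiable_scaleR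
        differentiable_diff d\<alpha> dB differentiable_const)
  have \<beta>0: "\<beta> p = 0" using BX[OF S(2)] by (simp add: \<beta>_def)
  have \<beta>_lim: "(\<beta> \<longlongrightarrow> 0) (at p)"
    using differentiable_imp_continuous_within[OF d\<beta>] \<beta>0 by (simp add: continuous_within)
  obtain C where C: "C > 0" "\<And>z. norm (K z) \<le> C * norm z"
    using linear_bounded_pos[OF K(1)] by auto
  \<comment> \<open>Where \<open>C e(x) < 1/2\<close>, the \<open>E\<close> term is at most half of \<open>|y|\<close> and can be moved to the left.\<close>
  have "\<forall>\<^sub>F x in at p. e x < 1 / (2 * C)"
    using order_tendstoD(2)[OF e0, of "1 / (2 * C)"] C by simp
  moreover have "\<forall>\<^sub>F x in at p. x \<in> S" using S by (auto simp: eventually_at_topological)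
  ultimately have "\<forall>\<^sub>F x in at p. norm (y x) \<le> 2 * C * norm (\<beta> x)"
  proof eventually_elim
    case (elim x)
    have "norm (y x) \<le> norm (K (\<beta> x)) + norm (K (E x (y x)))"
      by (subst y_eq[OF elim(2)]) (rule norm_triangle_ineq4)
    also have "\<dots> \<le> C * norm (\<beta> x) + C * (e x * norm (y x))"
      by (intro add_mono order_trans[OF C(2)] mult_left_mono E_bound elim) (use C(1) in auto)
    also have "C * (e x * norm (y x)) \<le> C * (1 / (2 * C) * norm (y x))"
      using elim(1) C(1) by (intro mult_left_mono mult_right_mono) auto
    finally show ?case using C(1) by simp
  qed
  then have y_lim: "(y \<longlongrightarrow> 0) (at p)"
    by (intro tendsto_0_le[OF \<beta>_lim, of _ "2 * C"]) (simp add: mult_ac)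
  have prod: "(\<lambda>x. (y x \<bullet> i) * (B x i b - B p i b)) differentiable (at p)" for i b
  proof -
    have "(\<lambda>x. B x i b - B p i b) differentiable (at p)"
      by (intro differentiable_diff dB differentiable_const)
    then obtain a' where a': "((\<lambda>x. B x i b - B p i b) has_derivative a') (at p)"
      unfolding differentiable_def by blast
    have "((\<lambda>x. y x \<bullet> i) \<longlongrightarrow> 0) (at p)" using tendsto_inner[OF y_lim tendsto_const, of i] by simp
    then have "((\<lambda>x. (y x \<bullet> i) * (B x i b - B p i b)) has_derivative (\<lambda>h. 0)) (at p)"
      by (intro has_derivative_vanishing_product[OF a']) (simp_all add: y_def)
    then show ?thesis unfolding differentiable_def by blast
  qed
  have "(\<lambda>x. E x (y x)) differentiable (at p)"
    by (rule differentiable_transform_within_open[OF _ S(1,2), rotated])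
      (auto simp: E_expand intro!: differentiable_sum differentiable_scaleR prod differentiable_const)
  moreover have KK: "K differentiable (at z)" for z
    using K(1) by (simp add: linear_imp_differentiable)
  ultimately have "(\<lambda>x. K (\<beta> x) - K (E x (y x))) differentiable (at p)"
    by (intro differentiable_diff differentiable_compose[OF KK] d\<beta>)
  then have "y differentiable (at p)"
    by (rule differentiable_transform_within_open[OF _ S]) (rule y_eq[symmetric])
  then have "(\<lambda>x. y x + X p) differentiable (at p)" by (intro differentiable_add differentiable_const)
  then show ?thesis by (simp add: y_def X_def)
qed

text \<open>The mean value theorem is applied twice: in the direction \<open>v\<close> to the difference
  \<open>f(\<cdot> + t w) - f\<close>, then in the direction \<open>w\<close> to the directional derivative of \<open>f\<close> along \<open>v\<close>.\<close>

lemma second_difference_mean_value: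
  fixes f :: "'x::real_normed_vector \<Rightarrow> real"
  assumes sub: "ball p e \<subseteq> S" and f: "\<And>x. x \<in> S \<Longrightarrow> f differentiable (at x)"
    and df: "\<And>x. x \<in> S \<Longrightarrow> (\<lambda>x. frechet_derivative f (at x) v) differentiable (at x)"
    and t: "0 < t" "t * (norm v + norm w) < e"
  shows "\<exists>\<xi>\<in>ball p e. f (p + t *\<^sub>R v + t *\<^sub>R w) - f (p + t *\<^sub>R v) - f (p + t *\<^sub>R w) + f p =
     t * t * frechet_derivative (\<lambda>x. frechet_derivative f (at x) v) (at \<xi>) w"
proof -
  have inball: "p + s *\<^sub>R v + r *\<^sub>R w \<in> ball p e" if "0 \<le> s" "s \<le> t" "0 \<le> r" "r \<le> t" for s r
  proof -
    have "norm (s *\<^sub>R v + r *\<^sub>R w) \<le> s * norm v + r * norm w"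
      using norm_triangle_ineq[of "s *\<^sub>R v" "r *\<^sub>R w"] that by simp
    also have "\<dots> \<le> t * norm v + t * norm w" using that by (intro add_mono mult_right_mono) auto
    finally have "norm (s *\<^sub>R v + r *\<^sub>R w) < e" using t by (simp add: algebra_simps)
    then show ?thesis using norm_minus_commute[of p "p + (s *\<^sub>R v + r *\<^sub>R w)"]
      by (simp add: dist_norm add.assoc)
  qed
  define Df where "Df x = frechet_derivative f (at x)" for x
  define D2 where "D2 x = frechet_derivative (\<lambda>x. Df x v) (at x)" for x
  have Df: "(f has_derivative Df x) (at x)" if "x \<in> ball p e" for x
    unfolding Df_def using f that sub by (simp add: frechet_derivative_works subset_iff)
  have D2: "((\<lambda>x. Df x v) has_derivative D2 x) (at x)" if "x \<in> ball p e" for x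
    unfolding Df_def D2_def using df that sub by (simp add: frechet_derivative_works subset_iff)
  have line: "((\<lambda>s. \<phi> (q + s *\<^sub>R z)) has_field_derivative \<phi>' z) (at s)"
    if "(\<phi> has_derivative \<phi>') (at (q + s *\<^sub>R z))" for \<phi> :: "'x \<Rightarrow> real" and \<phi>' q z s
  proof -
    have "((\<lambda>s. \<phi> (q + s *\<^sub>R z)) has_derivative (\<lambda>h. \<phi>' (h *\<^sub>R z))) (at s)"
      by (rule has_derivative_compose[of "\<lambda>s. q + s *\<^sub>R z" _ s UNIV \<phi> \<phi>', OF _ that]) (auto intro!: derivative_eq_intros)
    moreover have "\<phi>' (h *\<^sub>R z) = h * \<phi>' z" for h
      using has_derivative_linear[OF that] by (simp add: linear_cmul)
    ultimately show ?thesis by (simp add: has_field_derivative_def mult_commute_abs)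
  qed
  define \<phi> where "\<phi> s = f (p + t *\<^sub>R w + s *\<^sub>R v) - f (p + s *\<^sub>R v)" for s
  have "\<exists>s>0. s < t \<and> \<phi> t - \<phi> 0 =
      (t - 0) * (Df (p + t *\<^sub>R w + s *\<^sub>R v) v - Df (p + s *\<^sub>R v) v)"
    unfolding \<phi>_def
    by (rule MVT2[OF t(1)], rule DERIV_diff; rule line, rule Df)
       (use inball[of _ t] inball[of _ 0] t in \<open>auto simp: add_ac\<close>)
  then obtain s where s: "0 < s" "s < t"
    "\<phi> t - \<phi> 0 = t * (Df (p + t *\<^sub>R w + s *\<^sub>R v) v - Df (p + s *\<^sub>R v) v)" by auto
  have "\<exists>r>0. r < t \<and> Df (p + s *\<^sub>R v + t *\<^sub>R w) v - Df (p + s *\<^sub>R v + 0 *\<^sub>R w) v =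
      (t - 0) * D2 (p + s *\<^sub>R v + r *\<^sub>R w) w"
    by (rule MVT2[OF t(1)], rule line, rule D2) (use inball[of s] s in auto)
  then obtain r where r: "0 < r" "r < t"
    "Df (p + s *\<^sub>R v + t *\<^sub>R w) v - Df (p + s *\<^sub>R v) v = t * D2 (p + s *\<^sub>R v + r *\<^sub>R w) w" by auto
  have "f (p + t *\<^sub>R v + t *\<^sub>R w) - f (p + t *\<^sub>R v) - f (p + t *\<^sub>R w) + f p =
     t * t * D2 (p + s *\<^sub>R v + r *\<^sub>R w) w"
    using s(3) r(3) by (simp add: \<phi>_def add_ac)
  moreover have "p + s *\<^sub>R v + r *\<^sub>R w \<in> ball p e" using inball s r by auto
  ultimately show ?thesis unfolding D2_def Df_def by blast
qed

text \<open>The second difference is symmetric in \<open>v\<close> and \<open>w\<close>, so by the mean value theorem the two mixed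
  derivatives take a common value, at two points arbitrarily close to \<open>p\<close>; continuity concludes.\<close>

lemma second_derivative_symmetric_real:
  fixes f :: "'x::real_normed_vector \<Rightarrow> real"
  assumes S: "open S" "p \<in> S" and f: "\<And>x. x \<in> S \<Longrightarrow> f differentiable (at x)"
    and df: "\<And>x v. x \<in> S \<Longrightarrow> (\<lambda>x. frechet_derivative f (at x) v) differentiable (at x)"
    and cont: "\<And>v w. continuous_on S (\<lambda>x. frechet_derivative (\<lambda>x. frechet_derivative f (at x) v) (at x) w)"
  shows "frechet_derivative (\<lambda>x. frechet_derivative f (at x) v) (at p) w =
         frechet_derivative (\<lambda>x. frechet_derivative f (at x) w) (at p) v"
proof -
  define P where "P v w x = frechet_derivative (\<lambda>x. frechet_derivative f (at x) v) (at x) w" for v w x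
  have close: "\<exists>d>0. \<forall>x. dist x p < d \<longrightarrow> \<bar>P v w x - P v w p\<bar> < e" if "e > 0" for v w e
  proof -
    have "isCont (P v w) p" using cont S continuous_on_eq_continuous_at unfolding P_def by blast
    then show ?thesis using that unfolding continuous_at_eps_delta dist_real_def by blast
  qed
  have "\<bar>P v w p - P w v p\<bar> < e" if e: "e > 0" for e
  proof -
    obtain d1 where d1: "d1 > 0" "\<And>x. dist x p < d1 \<Longrightarrow> \<bar>P v w x - P v w p\<bar> < e/2"
      using close[of "e/2" v w] e by auto
    obtain d2 where d2: "d2 > 0" "\<And>x. dist x p < d2 \<Longrightarrow> \<bar>P w v x - P w v p\<bar> < e/2"
      using close[of "e/2" w v] e by auto
    obtain d3 where d3: "d3 > 0" "ball p d3 \<subseteq> S" using S open_contains_ball by blast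
    define d where "d = min d1 (min d2 d3)"
    have d: "d > 0" "ball p d \<subseteq> S" using d1 d2 d3 by (auto simp: d_def)
    define t where "t = d / (norm v + norm w + 1)"
    have pos: "norm v + norm w + 1 > 0" by (simp add: add_nonneg_pos)
    have t: "0 < t" "t * (norm v + norm w) < d"
      using d(1) pos by (simp_all add: t_def field_simps)
    obtain \<xi> where \<xi>: "\<xi> \<in> ball p d"
       "f (p + t *\<^sub>R v + t *\<^sub>R w) - f (p + t *\<^sub>R v) - f (p + t *\<^sub>R w) + f p = t * t * P v w \<xi>"
      using second_difference_mean_value[OF d(2) f df t] unfolding P_def by blast
    obtain \<eta> where \<eta>: "\<eta> \<in> ball p d"
       "f (p + t *\<^sub>R w + t *\<^sub>R v) - f (p + t *\<^sub>R w) - f (p + t *\<^sub>R v) + f p = t * t * P w v \<eta>"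
      using second_difference_mean_value[OF d(2) f df t(1), of w v] t(2) unfolding P_def
      by (auto simp: add.commute)
    have swap: "p + t *\<^sub>R w + t *\<^sub>R v = p + t *\<^sub>R v + t *\<^sub>R w" by (simp add: add_ac)
    have "t * t * P v w \<xi> = t * t * P w v \<eta>" 
      using \<xi>(2) \<eta>(2)[unfolded swap] by linarith
    then have "P v w \<xi> = P w v \<eta>" using t(1) by simp
    moreover have "\<bar>P v w \<xi> - P v w p\<bar> < e/2" using \<xi>(1) d1(2) by (simp add: d_def dist_commute)
    moreover have "\<bar>P w v \<eta> - P w v p\<bar> < e/2" using \<eta>(1) d2(2) by (simp add: d_def dist_commute)
    ultimately show ?thesis by (simp add: abs_if split: if_splits)
  qed
  from this[of "\<bar>P v w p - P w v p\<bar>"] have "P v w p = P w v p" by auto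
  then show ?thesis by (simp add: P_def)
qed

lemma C_2_onD:
  assumes "C_k_on 2 S f" "x \<in> S"
  shows "f differentiable (at x)" "(\<lambda>x. frechet_derivative f (at x) v) differentiable (at x)"
  using assms by (auto simp: numeral_2_eq_2)

lemma differentiable_inner_left:
  assumes "f differentiable (at x)"
  shows "(\<lambda>x. f x \<bullet> b) differentiable (at x)"
  using has_derivative_inner_left[OF assms[unfolded frechet_derivative_works], of b]
  unfolding differentiable_def by blast

lemma frechet_derivative_inner:
  assumes "f differentiable (at x)"
  shows "frechet_derivative (\<lambda>x. f x \<bullet> b) (at x) v = frechet_derivative f (at x) v \<bullet> b"
  using fun_cong[OF frechet_derivative_at[OF has_derivative_inner_left[OF
      assms[unfolded frechet_derivative_works], of b]], of v]
  by simp

text \<open>The real case, applied to each component of \<open>f\<close>.\<close>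

lemma second_derivative_symmetric:
  fixes f :: "'x::euclidean_space \<Rightarrow> 'y::euclidean_space"
  assumes S: "open S" "p \<in> S" and f: "C_k_on 2 S f"
  shows "frechet_derivative (\<lambda>x. frechet_derivative f (at x) v) (at p) w =
         frechet_derivative (\<lambda>x. frechet_derivative f (at x) w) (at p) v"
proof (rule euclidean_eqI)
  fix b :: 'y assume "b \<in> Basis"
  define k where "k x = f x \<bullet> b" for x
  note D = C_2_onD[OF f]
  have k1: "frechet_derivative k (at x) v = frechet_derivative f (at x) v \<bullet> b" if "x \<in> S" for x v
    unfolding k_def by (rule frechet_derivative_inner[OF D(1)[OF that]])
  have dk: "k differentiable (at x)" if "x \<in> S" for x
    unfolding k_def by (rule differentiable_inner_left[OF D(1)[OF that]])
  have dk2: "(\<lambda>x. frechet_derivative k (at x) v) differentiable (at x)" if "x \<in> S" for x v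
    by (rule differentiable_transform_within_open[OF _ S(1) that, of "\<lambda>x. frechet_derivative f (at x) v \<bullet> b"])
      (simp_all add: k1 differentiable_inner_left[OF D(2)[OF that]])
  have k2: "frechet_derivative (\<lambda>x. frechet_derivative k (at x) v) (at x) w =
      frechet_derivative (\<lambda>x. frechet_derivative f (at x) v) (at x) w \<bullet> b" if "x \<in> S" for x v w
    by (subst frechet_derivative_inner[OF D(2)[OF that], symmetric],
        subst frechet_derivative_transform_within_open[OF dk2[OF that] S(1) that k1]) auto
  have "continuous_on S (\<lambda>x. frechet_derivative (\<lambda>x. frechet_derivative k (at x) v) (at x) w)" for v w
    using f by (simp add: numeral_2_eq_2 k2 continuous_on_inner continuous_on_const cong: continuous_on_cong)
  then show "frechet_derivative (\<lambda>x. frechet_derivative f (at x) v) (at p) w \<bullet> b =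
         frechet_derivative (\<lambda>x. frechet_derivative f (at x) w) (at p) v \<bullet> b"
    using second_derivative_symmetric_real[OF S dk dk2, of v w] k2 S(2) by simp
qed

section \<open>The Levi-Civita connection in overlapping charts\<close>

text \<open>The shape of the right-hand side of the Koszul formula.\<close>

lemma linear_koszul_combination:
  fixes a b c :: "'x::real_vector \<Rightarrow> real"
  assumes "linear a" "linear b" "linear c"
  shows "linear (\<lambda>z. (a z + b z - c z) / 2)"
  using assms by (auto simp: linear_iff field_simps)

locale pseudo_riemannian =
  fixes A :: "('a::{t2_space, second_countable_topology}, 'e::euclidean_space) chart set"
    and g :: "('a, 'e) metric"
  assumes prm: "pseudo_riemannian_manifold A g"
begin

lemma chart: "c \<in> A \<Longrightarrow> is_chart c"
  using prm unfolding pseudo_riemannian_manifold_def smooth_atlas_def by blast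

lemma open_chart_image: "c \<in> A \<Longrightarrow> open (chart_map c ` chart_dom c)"
  using chart unfolding is_chart_def by blast

lemma chart_inv_map: "c \<in> A \<Longrightarrow> p \<in> chart_dom c \<Longrightarrow> chart_inv c (chart_map c p) = p"
  using chart unfolding is_chart_def homeomorphism_def by blast

lemma open_overlap:
  assumes "c \<in> A" "d \<in> A"
  shows "open (chart_map c ` (chart_dom c \<inter> chart_dom d))"
proof -
  have c: "homeomorphism (chart_dom c) (chart_map c ` chart_dom c) (chart_map c) (chart_inv c)"
    and o: "open (chart_dom d)"
    using chart assms unfolding is_chart_def by blast+
  have "openin (top_of_set (chart_map c ` chart_dom c)) (chart_map c ` (chart_dom c \<inter> chart_dom d))"
    by (rule homeomorphism_imp_open_map[OF c]) (simp add: o openin_open_Int)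
  then show ?thesis using open_chart_image[OF assms(1)] openin_open_trans by blast
qed

lemma transition_chart_map:
  "c \<in> A \<Longrightarrow> p \<in> chart_dom c \<Longrightarrow> transition c d (chart_map c p) = chart_map d p"
  by (simp add: transition_def chart_inv_map)

lemma C_2_transition:
  assumes "c \<in> A" "d \<in> A"
  shows "C_k_on 2 (chart_map c ` (chart_dom c \<inter> chart_dom d)) (transition c d)"
  using prm assms unfolding pseudo_riemannian_manifold_def smooth_atlas_def smooth_on_def by blast

lemma chart_at_mem:
  assumes "p \<in> manifold_points A"
  shows "chart_at A p \<in> A" "p \<in> chart_dom (chart_at A p)"
proof -
  have "\<exists>c. c \<in> A \<and> p \<in> chart_dom c" using assms unfolding manifold_points_def by blast
  from someI_ex[OF this] show "chart_at A p \<in> A" "p \<in> chart_dom (chart_at A p)"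
    unfolding chart_at_def by blast+
qed

lemma metric:
  assumes "c \<in> A" "p \<in> chart_dom c"
  shows bilinear_metric: "bilinear (g c p)" and metric_sym: "g c p v w = g c p w v"
    and nondegenerate_metric: "nondegenerate (g c p)"
  using prm assms unfolding pseudo_riemannian_manifold_def pseudo_riemannian_metric_def by blast+

lemma metric_transition:
  assumes "c \<in> A" "d \<in> A" "p \<in> chart_dom c" "p \<in> chart_dom d"
  shows "g c p v w = g d p (frechet_derivative (transition c d) (at (chart_map c p)) v)
                           (frechet_derivative (transition c d) (at (chart_map c p)) w)"
  using prm assms unfolding pseudo_riemannian_manifold_def pseudo_riemannian_metric_def by blast

lemma has_derivative_metric:
  assumes "c \<in> A" "p \<in> chart_dom c"
  shows "((\<lambda>x. g c (chart_inv c x) v w) has_derivative (\<lambda>z. metric_deriv g c p z v w))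
           (at (chart_map c p))"
proof -
  have "C_k_on 2 (chart_map c ` chart_dom c) (\<lambda>x. g c (chart_inv c x) v w)"
    using prm assms(1)
    unfolding pseudo_riemannian_manifold_def pseudo_riemannian_metric_def smooth_on_def by blast
  from C_2_onD(1)[OF this] assms(2) show ?thesis
    unfolding metric_deriv_def by (simp flip: frechet_derivative_works)
qed

lemma linear_metric_deriv:
  "c \<in> A \<Longrightarrow> p \<in> chart_dom c \<Longrightarrow> linear (\<lambda>z. metric_deriv g c p z v w)"
  using has_derivative_metric has_derivative_linear by blast

lemma bilinear_metric_deriv:
  assumes "c \<in> A" "p \<in> chart_dom c"
  shows "bilinear (metric_deriv g c p z)"
proof -
  have "bilinear (\<lambda>v w. metric_deriv g c p z v w)"
  proof (rule bilinear_derivative_of_family[OF open_chart_image[OF assms(1)] _ _ has_derivative_metric[OF assms]])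
    show "bilinear (g c (chart_inv c x))" if "x \<in> chart_map c ` chart_dom c" for x
      using that assms(1) by (auto simp: chart_inv_map bilinear_metric)
  qed (use assms(2) in blast)
  then show ?thesis by simp
qed

lemma metric_deriv_sym:
  assumes "c \<in> A" "p \<in> chart_dom c"
  shows "metric_deriv g c p z v w = metric_deriv g c p z w v"
proof -
  have "((\<lambda>x. g c (chart_inv c x) v w) has_derivative (\<lambda>z. metric_deriv g c p z w v)) (at (chart_map c p))"
  proof (rule has_derivative_transform_within_open[OF has_derivative_metric[OF assms]
        open_chart_image[OF assms(1)]])
    show "g c (chart_inv c x) w v = g c (chart_inv c x) v w" if "x \<in> chart_map c ` chart_dom c" for x
      using that assms(1) by (auto simp: chart_inv_map intro: metric_sym)
  qed (use assms(2) in blast)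
  from has_derivative_unique[OF has_derivative_metric[OF assms] this, THEN fun_cong, of z]
  show ?thesis .
qed

text \<open>The Koszul formula for coordinate fields.\<close>

lemma christoffel_works:
  assumes "c \<in> A" "p \<in> chart_dom c"
  shows "g c p (christoffel g c p v w) z =
    (metric_deriv g c p v w z + metric_deriv g c p w v z - metric_deriv g c p z v w) / 2"
  unfolding christoffel_def
  by (rule sharp_works[OF bilinear_metric[OF assms] nondegenerate_metric[OF assms]])
     (intro linear_koszul_combination linear_metric_deriv[OF assms];
       use bilinear_metric_deriv[OF assms] in \<open>simp add: bilinear_def\<close>)

lemma metric_cancel:
  assumes "c \<in> A" "p \<in> chart_dom c" "\<And>z. g c p v z = g c p w z"
  shows "v = w"
proof -
  have "\<forall>z. g c p (v - w) z = 0" using assms(3) by (simp add: bilinear_lsub[OF bilinear_metric[OF assms(1,2)]])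
  then show ?thesis using nondegenerate_metric[OF assms(1,2)] unfolding nondegenerate_def by force
qed

lemma bilinear_christoffel:
  assumes "c \<in> A" "p \<in> chart_dom c"
  shows "bilinear (christoffel g c p)"
proof -
  note simps = christoffel_works[OF assms] bilinear_ladd[OF bilinear_metric[OF assms]]
    bilinear_lmul[OF bilinear_metric[OF assms]]
    bilinear_ladd[OF bilinear_metric_deriv[OF assms]] bilinear_lmul[OF bilinear_metric_deriv[OF assms]]
    bilinear_radd[OF bilinear_metric_deriv[OF assms]] bilinear_rmul[OF bilinear_metric_deriv[OF assms]]
    linear_add[OF linear_metric_deriv[OF assms]] linear_cmul[OF linear_metric_deriv[OF assms]]
  show ?thesis
    unfolding bilinear_def
    by (intro conjI allI linearI metric_cancel[OF assms]) (simp_all add: simps field_simps)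
qed

lemma transition_differentiable:
  assumes "c \<in> A" "d \<in> A" "p \<in> chart_dom c" "p \<in> chart_dom d"
  shows "transition c d differentiable (at (chart_map c p))"
  using C_2_onD(1)[OF C_2_transition[OF assms(1,2)]] assms(3,4) by blast

lemma linear_transition_derivative:
  assumes "c \<in> A" "d \<in> A" "p \<in> chart_dom c" "p \<in> chart_dom d"
  shows "linear (frechet_derivative (transition c d) (at (chart_map c p)))"
  using linear_frechet_derivative[OF transition_differentiable[OF assms]] .

lemma transition_derivative_inverse:
  assumes "c \<in> A" "d \<in> A" "p \<in> chart_dom c" "p \<in> chart_dom d"
  shows "frechet_derivative (transition d c) (at (chart_map d p))
           (frechet_derivative (transition c d) (at (chart_map c p)) v) = v"
proof -
  let ?x = "chart_map c p"
  have "((transition d c \<circ> transition c d) has_derivative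
      (frechet_derivative (transition d c) (at (chart_map d p)) \<circ> frechet_derivative (transition c d) (at ?x)))
      (at ?x)"
    using transition_differentiable[OF assms] transition_differentiable[OF assms(2,1,4,3)]
    by (intro diff_chain_at) (simp_all add: transition_chart_map assms frechet_derivative_works[symmetric])
  moreover have "((transition d c \<circ> transition c d) has_derivative (\<lambda>v. v)) (at ?x)"
    by (rule has_derivative_transform_within_open[OF has_derivative_ident open_overlap[OF assms(1,2)]])
       (use assms in \<open>auto simp: transition_chart_map\<close>)
  ultimately show ?thesis by (auto dest: has_derivative_unique simp: fun_eq_iff)
qed

text \<open>The product rule for \<open>g\<^sub>c(v, w) = (g\<^sub>d \<circ> \<tau>)(d\<tau> v, d\<tau> w)\<close>; the terms with \<open>D2\<close> come from
  differentiating \<open>d\<tau>\<close>.\<close>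

lemma metric_deriv_transition:
  assumes c: "c \<in> A" and d: "d \<in> A" and p: "p \<in> chart_dom c" "p \<in> chart_dom d"
  defines "J \<equiv> frechet_derivative (transition c d) (at (chart_map c p))"
    and "D2 \<equiv> \<lambda>z v. frechet_derivative (\<lambda>x. frechet_derivative (transition c d) (at x) v)
                    (at (chart_map c p)) z"
  shows "metric_deriv g c p z v w =
    metric_deriv g d p (J z) (J v) (J w) + g d p (D2 z v) (J w) + g d p (J v) (D2 z w)"
proof -
  let ?S = "chart_map c ` (chart_dom c \<inter> chart_dom d)"
  let ?DT = "\<lambda>v x. frechet_derivative (transition c d) (at x) v"
  let ?B = "\<lambda>x. g d (chart_inv d (transition c d x))"
  note S = open_overlap[OF c d]
  have x: "chart_map c p \<in> ?S" using p by blast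
  have Td: "(transition c d has_derivative J) (at (chart_map c p))"
    using transition_differentiable[OF c d p] unfolding J_def frechet_derivative_works .
  have B: "bilinear (?B x)" if "x \<in> ?S" for x
    using that c d by (auto simp: transition_chart_map chart_inv_map bilinear_metric)
  have dB: "((\<lambda>x. ?B x v w) has_derivative (\<lambda>z. metric_deriv g d p (J z) v w)) (at (chart_map c p))" for v w
    using diff_chain_at[OF Td, of "\<lambda>y. g d (chart_inv d y) v w" "\<lambda>z. metric_deriv g d p z v w"]
      has_derivative_metric[OF d p(2)] c p(1)
    by (simp add: o_def transition_chart_map)
  have D2: "(?DT v has_derivative (\<lambda>z. D2 z v)) (at (chart_map c p))" for v
    using C_2_onD(2)[OF C_2_transition[OF c d] x] unfolding D2_def frechet_derivative_works .
  have "((\<lambda>x. g c (chart_inv c x) v w) has_derivative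
      (\<lambda>h. metric_deriv g d p (J h) (J v) (J w) + g d p (D2 h v) (J w) + g d p (J v) (D2 h w)))
      (at (chart_map c p))"
  proof (rule has_derivative_transform_within_open[OF _ S x])
    show "((\<lambda>x. ?B x (?DT v x) (?DT w x)) has_derivative
      (\<lambda>h. metric_deriv g d p (J h) (J v) (J w) + g d p (D2 h v) (J w) + g d p (J v) (D2 h w)))
      (at (chart_map c p))"
      using has_derivative_bilinear_family[OF S x B dB D2 D2, of v w] c d p
      by (simp add: transition_chart_map chart_inv_map J_def)
    show "?B x (?DT v x) (?DT w x) = g c (chart_inv c x) v w" if "x \<in> ?S" for x
      using that c d metric_transition[OF c d] by (auto simp: transition_chart_map chart_inv_map)
  qed
  from has_derivative_unique[OF has_derivative_metric[OF c p(1)] this, THEN fun_cong, of z]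
  show ?thesis .
qed

text \<open>The transformation law of the Christoffel symbols. In the Koszul combination of
  \<open>metric_deriv_transition\<close>, the symmetry of \<open>D2\<close> cancels four of the six second-derivative terms
  and makes the other two equal.\<close>

lemma christoffel_transition:
  assumes c: "c \<in> A" and d: "d \<in> A" and p: "p \<in> chart_dom c" "p \<in> chart_dom d"
  defines "J \<equiv> frechet_derivative (transition c d) (at (chart_map c p))"
    and "D2 \<equiv> \<lambda>z v. frechet_derivative (\<lambda>x. frechet_derivative (transition c d) (at x) v)
                    (at (chart_map c p)) z"
  shows "D2 v w + christoffel g d p (J v) (J w) = J (christoffel g c p v w)"
proof (rule metric_cancel[OF d p(2)])
  fix z
  \<comment> \<open>Every test vector is in the range of \<open>J\<close>, so both sides can be tested by vectors \<open>J ?z\<close>.\<close>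
  let ?z = "frechet_derivative (transition d c) (at (chart_map d p)) z"
  have z: "z = J ?z" using transition_derivative_inverse[OF d c p(2,1)] by (simp add: J_def)
  have D2_sym: "D2 v w = D2 w v" for v w
    unfolding D2_def
    by (rule second_derivative_symmetric[OF open_overlap[OF c d] _ C_2_transition[OF c d]])
       (use p in blast)
  have md: "metric_deriv g c p z v w =
      metric_deriv g d p (J z) (J v) (J w) + g d p (D2 z v) (J w) + g d p (J v) (D2 z w)" for z v w
    unfolding J_def D2_def by (rule metric_deriv_transition[OF c d p])
  note sym = metric_sym[OF d p(2)]
  have "g d p (J (christoffel g c p v w)) (J ?z) = g c p (christoffel g c p v w) ?z"
    unfolding J_def by (rule metric_transition[OF c d p, symmetric])
  also have "\<dots> = g d p (D2 v w + christoffel g d p (J v) (J w)) (J ?z)"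
    unfolding christoffel_works[OF c p(1)] md bilinear_ladd[OF bilinear_metric[OF d p(2)]]
      christoffel_works[OF d p(2)]
    using D2_sym[of ?z v] D2_sym[of ?z w] D2_sym[of w v] sym[of "J w" "D2 v ?z"]
    by (simp add: field_simps)
  finally show "g d p (D2 v w + christoffel g d p (J v) (J w)) z = g d p (J (christoffel g c p v w)) z"
    using z by simp
qed

text \<open>Scaling by \<open>\<phi>\<close> changes the endomorphism \<open>v \<mapsto> \<nabla>\<^sub>v X\<close> into \<open>\<phi> \<nabla>X\<close> plus the rank one map
  \<open>v \<mapsto> d\<phi>(v) X\<close>, whose trace is \<open>d\<phi>(X)\<close>.\<close>

lemma divergence_scaleR:
  assumes p: "p \<in> manifold_points A" and c: "c = chart_at A p"
    and \<phi>: "(\<phi> \<circ> chart_inv c has_derivative \<phi>') (at (chart_map c p))"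
    and X: "X c \<circ> chart_inv c differentiable (at (chart_map c p))"
  shows "divergence A g (\<lambda>c q. \<phi> q *\<^sub>R X c q) p = \<phi> p * divergence A g X p + \<phi>' (X c p)"
proof -
  have cA: "c \<in> A" "p \<in> chart_dom c" using chart_at_mem[OF p] c by auto
  let ?x = "chart_map c p"
  let ?X' = "frechet_derivative (X c \<circ> chart_inv c) (at ?x)"
  have "((\<lambda>x. (\<phi> \<circ> chart_inv c) x *\<^sub>R (X c \<circ> chart_inv c) x) has_derivative
      (\<lambda>h. \<phi> p *\<^sub>R ?X' h + \<phi>' h *\<^sub>R X c p)) (at ?x)"
    using has_derivative_scaleR[OF \<phi> X[unfolded frechet_derivative_works]]
    by (simp add: chart_inv_map[OF cA])
  then have "frechet_derivative ((\<lambda>q. \<phi> q *\<^sub>R X c q) \<circ> chart_inv c) (at ?x) =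
      (\<lambda>h. \<phi> p *\<^sub>R ?X' h + \<phi>' h *\<^sub>R X c p)"
    using frechet_derivative_at by (fastforce simp: o_def)
  then have "covariant_derivative g (\<lambda>c q. \<phi> q *\<^sub>R X c q) c p =
      (\<lambda>v. \<phi> p *\<^sub>R covariant_derivative g X c p v + \<phi>' v *\<^sub>R X c p)"
    by (simp add: fun_eq_iff covariant_derivative_def bilinear_rmul[OF bilinear_christoffel[OF cA]]
        algebra_simps)
  then have "divergence A g (\<lambda>c q. \<phi> q *\<^sub>R X c q) p =
     endo_trace (\<lambda>v. \<phi> p *\<^sub>R covariant_derivative g X c p v + \<phi>' v *\<^sub>R X c p)"
    by (simp add: divergence_def endo_trace_def c)
  then show ?thesis
    by (simp add: endo_trace_add endo_trace_scaleR endo_trace_rank_one has_derivative_linear[OF \<phi>])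
       (simp add: divergence_def endo_trace_def c)
qed

end

section \<open>The Hessian and the gradient of a function\<close>

text \<open>The covariant second derivative \<open>v(w u) - (\<nabla>\<^sub>v w) u\<close> for \<open>w\<close> with constant components. The
  direction \<open>v\<close> of the outer derivative is the first argument, as in \<open>second_fundamental_form\<close>.\<close>

definition hessian ::
  "('a, 'e::euclidean_space) metric \<Rightarrow> ('a \<Rightarrow> real) \<Rightarrow> ('a, 'e) chart \<Rightarrow> 'a \<Rightarrow> 'e \<Rightarrow> 'e \<Rightarrow> real" where
  "hessian g u c p v w =
     frechet_derivative (\<lambda>x. frechet_derivative (u \<circ> chart_inv c) (at x) w) (at (chart_map c p)) v
     - frechet_derivative (u \<circ> chart_inv c) (at (chart_map c p)) (christoffel g c p v w)"

locale C2_function = pseudo_riemannian A g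
  for A :: "('a::{t2_space, second_countable_topology}, 'e::euclidean_space) chart set"
    and g :: "('a, 'e) metric" +
  fixes u :: "'a \<Rightarrow> real"
  assumes C2: "C_k_function 2 A u"
begin

abbreviation du :: "('a, 'e) chart \<Rightarrow> 'a \<Rightarrow> 'e \<Rightarrow> real" where
  "du c p \<equiv> frechet_derivative (u \<circ> chart_inv c) (at (chart_map c p))"

lemma C_2_on_chart: "c \<in> A \<Longrightarrow> C_k_on 2 (chart_map c ` chart_dom c) (u \<circ> chart_inv c)"
  using C2 unfolding C_k_function_def by blast

lemma has_derivative_u:
  assumes "c \<in> A" "p \<in> chart_dom c"
  shows "(u \<circ> chart_inv c has_derivative du c p) (at (chart_map c p))"
  using C_2_onD(1)[OF C_2_on_chart[OF assms(1)]] assms(2) unfolding frechet_derivative_works by blast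

lemma linear_du: "c \<in> A \<Longrightarrow> p \<in> chart_dom c \<Longrightarrow> linear (du c p)"
  using has_derivative_u has_derivative_linear by blast

lemma has_derivative_du:
  assumes "c \<in> A" "p \<in> chart_dom c"
  shows "((\<lambda>x. frechet_derivative (u \<circ> chart_inv c) (at x) w) has_derivative
    (\<lambda>v. hessian g u c p v w + du c p (christoffel g c p v w))) (at (chart_map c p))"
  using C_2_onD(2)[OF C_2_on_chart[OF assms(1)], of "chart_map c p" w] assms(2)
  unfolding frechet_derivative_works by (simp add: hessian_def)

lemma du_transition:
  assumes c: "c \<in> A" and d: "d \<in> A" and p: "p \<in> chart_dom c" "p \<in> chart_dom d"
  shows "du c p v = du d p (frechet_derivative (transition c d) (at (chart_map c p)) v)"
proof -
  have "((u \<circ> chart_inv d) \<circ> transition c d has_derivative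
      du d p \<circ> frechet_derivative (transition c d) (at (chart_map c p))) (at (chart_map c p))"
    using transition_differentiable[OF assms] has_derivative_u[OF d p(2)]
    by (intro diff_chain_at) (simp_all add: transition_chart_map c p flip: frechet_derivative_works)
  then have "(u \<circ> chart_inv c has_derivative
      du d p \<circ> frechet_derivative (transition c d) (at (chart_map c p))) (at (chart_map c p))"
    by (rule has_derivative_transform_within_open[OF _ open_overlap[OF c d]])
       (use c d p in \<open>auto simp: transition_chart_map chart_inv_map\<close>)
  from has_derivative_unique[OF has_derivative_u[OF c p(1)] this] show ?thesis by simp
qed

lemma gradient_works:
  assumes "c \<in> A" "p \<in> chart_dom c"
  shows "g c p (gradient g u c p) v = du c p v"
  unfolding gradient_def
  by (rule sharp_works[OF bilinear_metric[OF assms] nondegenerate_metric[OF assms] linear_du[OF assms]])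

lemma gradient_transition:
  assumes c: "c \<in> A" and d: "d \<in> A" and p: "p \<in> chart_dom c" "p \<in> chart_dom d"
  shows "frechet_derivative (transition c d) (at (chart_map c p)) (gradient g u c p) = gradient g u d p"
proof (rule metric_cancel[OF d p(2)])
  fix z
  let ?J = "frechet_derivative (transition c d) (at (chart_map c p))"
  let ?z = "frechet_derivative (transition d c) (at (chart_map d p)) z"
  have z: "z = ?J ?z" using transition_derivative_inverse[OF d c p(2,1)] by simp
  have "g d p (?J (gradient g u c p)) (?J ?z) = du c p ?z"
    by (simp add: metric_transition[OF c d p, symmetric] gradient_works c p)
  also have "\<dots> = du d p (?J ?z)" by (rule du_transition[OF c d p])
  finally show "g d p (?J (gradient g u c p)) z = g d p (gradient g u d p) z"
    using z by (simp add: gradient_works d p)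
qed

text \<open>\<open>norm_sq\<close> at a point \<open>q\<close> uses the chart chosen for \<open>q\<close>, which may vary with \<open>q\<close>. To differentiate it,
  one needs its value in a single chart around the point.\<close>

lemma norm_sq_gradient:
  assumes c: "c \<in> A" and p: "p \<in> chart_dom c"
  shows "norm_sq A g (gradient g u) p = du c p (gradient g u c p)"
proof -
  have "p \<in> manifold_points A" using assms unfolding manifold_points_def by blast
  note d = chart_at_mem[OF this]
  show ?thesis
    unfolding norm_sq_def Let_def gradient_works[OF d] du_transition[OF d(1) c d(2) p]
      gradient_transition[OF d(1) c d(2) p] ..
qed

text \<open>Linearity in \<open>w\<close> passes to the derivative by uniqueness: linearity of \<open>du\<close> holds at all points
  near \<open>p\<close>.\<close>

lemma bilinear_hessian:
  assumes "c \<in> A" "p \<in> chart_dom c"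
  shows "bilinear (hessian g u c p)"
proof -
  define D2 where "D2 w v = hessian g u c p v w + du c p (christoffel g c p v w)" for v w
  note D2 = has_derivative_du[OF assms, folded D2_def]
  have lin1: "linear (\<lambda>v. D2 w v)" for w using has_derivative_linear[OF D2] .
  have inS: "chart_map c p \<in> chart_map c ` chart_dom c" using assms(2) by blast
  have linf: "linear (frechet_derivative (u \<circ> chart_inv c) (at x))" if "x \<in> chart_map c ` chart_dom c" for x
    using that linear_du[OF assms(1)] by auto
  have "linear (\<lambda>w. D2 w v)" for v
  proof (rule linearI)
    note uniq = has_derivative_unique[OF D2 has_derivative_transform_within_open[OF _
        open_chart_image[OF assms(1)] inS], THEN fun_cong]
    show "D2 (w + w') v = D2 w v + D2 w' v" for w w'
      by (rule uniq, rule has_derivative_add[OF D2 D2]) (simp add: linear_add linf)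
    show "D2 (r *\<^sub>R w) v = r *\<^sub>R D2 w v" for w r
      by (rule uniq, rule has_derivative_scaleR_right[OF D2]) (simp add: linear_cmul linf)
  qed
  moreover have "hessian g u c p = (\<lambda>v w. D2 w v - du c p (christoffel g c p v w))"
    by (simp add: D2_def fun_eq_iff)
  moreover have comp: "linear (\<lambda>v. du c p (h v))" if "linear h" for h :: "'e \<Rightarrow> 'e"
    using linear_compose[OF that linear_du[OF assms]] by (simp only: comp_def[of "du c p" h])
  have "linear (\<lambda>v. du c p (christoffel g c p v w))"
    and "linear (\<lambda>v. du c p (christoffel g c p w v))" for w
    using bilinear_christoffel[OF assms] by (auto simp: bilinear_def intro!: comp)
  ultimately show ?thesis
    unfolding bilinear_def using lin1 by (simp add: linear_compose_sub)
qed

text \<open>Differentiating \<open>du\<^sub>c = (du\<^sub>d \<circ> \<tau>) d\<tau>\<close> produces the extra term \<open>du\<^sub>d(D\<^sup>2\<tau>)\<close>, which is the one that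
  appears in the transformation law of the Christoffel symbols.\<close>

lemma hessian_transition:
  assumes c: "c \<in> A" and d: "d \<in> A" and p: "p \<in> chart_dom c" "p \<in> chart_dom d"
  defines "J \<equiv> frechet_derivative (transition c d) (at (chart_map c p))"
  shows "hessian g u c p v w = hessian g u d p (J v) (J w)"
proof -
  let ?S = "chart_map c ` (chart_dom c \<inter> chart_dom d)"
  let ?\<alpha> = "\<lambda>x. frechet_derivative (u \<circ> chart_inv d) (at (transition c d x))"
  let ?DT = "\<lambda>x. frechet_derivative (transition c d) (at x) w"
  define D2 where "D2 v = frechet_derivative (\<lambda>x. frechet_derivative (transition c d) (at x) w)
                    (at (chart_map c p)) v" for v
  note S = open_overlap[OF c d]
  have x: "chart_map c p \<in> ?S" using p by blast
  have Td: "(transition c d has_derivative J) (at (chart_map c p))"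
    using transition_differentiable[OF c d p] unfolding J_def frechet_derivative_works .
  have lin: "linear (?\<alpha> x)" if "x \<in> ?S" for x
    using that c d by (auto simp: transition_chart_map linear_du)
  have d\<alpha>: "((\<lambda>x. ?\<alpha> x v) has_derivative
      (\<lambda>z. hessian g u d p (J z) v + du d p (christoffel g d p (J z) v))) (at (chart_map c p))" for v
    using diff_chain_at[OF Td, of "\<lambda>y. frechet_derivative (u \<circ> chart_inv d) (at y) v"]
      has_derivative_du[OF d p(2), of v] c p(1)
    by (fastforce simp: o_def transition_chart_map)
  have D2: "(?DT has_derivative D2) (at (chart_map c p))"
    using C_2_onD(2)[OF C_2_transition[OF c d] x] unfolding D2_def frechet_derivative_works .
  have "((\<lambda>x. frechet_derivative (u \<circ> chart_inv c) (at x) w) has_derivative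
      (\<lambda>h. hessian g u d p (J h) (J w) + du d p (christoffel g d p (J h) (J w)) + du d p (D2 h)))
      (at (chart_map c p))"
  proof (rule has_derivative_transform_within_open[OF _ S x])
    show "((\<lambda>x. ?\<alpha> x (?DT x)) has_derivative
      (\<lambda>h. hessian g u d p (J h) (J w) + du d p (christoffel g d p (J h) (J w)) + du d p (D2 h)))
      (at (chart_map c p))"
      using has_derivative_linear_family[OF S x lin d\<alpha> D2] c p
      by (simp add: transition_chart_map J_def)
    show "?\<alpha> x (?DT x) = frechet_derivative (u \<circ> chart_inv c) (at x) w" if "x \<in> ?S" for x
      using that c d du_transition[OF c d] by (auto simp: transition_chart_map)
  qed
  from has_derivative_unique[OF has_derivative_du[OF c p(1)] this, THEN fun_cong, of v]
  have "hessian g u c p v w + du c p (christoffel g c p v w) =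
    hessian g u d p (J v) (J w) + (du d p (christoffel g d p (J v) (J w)) + du d p (D2 v))"
    by simp
  moreover have "du c p (christoffel g c p v w) = du d p (D2 v + christoffel g d p (J v) (J w))"
    unfolding du_transition[OF c d p] christoffel_transition[OF c d p, symmetric] J_def D2_def ..
  ultimately show ?thesis by (simp add: linear_add[OF linear_du[OF d p(2)]])
qed

lemma gradient_differentiable:
  assumes c: "c \<in> A" and p: "p \<in> chart_dom c"
  shows "gradient g u c \<circ> chart_inv c differentiable (at (chart_map c p))"
proof (rule differentiable_transform_within_open[OF _ open_chart_image[OF c]])
  let ?S = "chart_map c ` chart_dom c"
  show "(\<lambda>x. sharp (g c (chart_inv c x)) (frechet_derivative (u \<circ> chart_inv c) (at x)))
    differentiable (at (chart_map c p))"
  proof (rule differentiable_sharp[OF open_chart_image[OF c]])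
    show "(\<lambda>x. g c (chart_inv c x) v w) differentiable (at (chart_map c p))" for v w
      using has_derivative_metric[OF c p] unfolding differentiable_def by blast
    show "(\<lambda>x. frechet_derivative (u \<circ> chart_inv c) (at x) v) differentiable (at (chart_map c p))" for v
      using has_derivative_du[OF c p] unfolding differentiable_def by blast
  qed (use c p in \<open>auto simp: chart_inv_map bilinear_metric nondegenerate_metric linear_du\<close>)
qed (use c p in \<open>auto simp: chart_inv_map gradient_def\<close>)

text \<open>Differentiating \<open>g(\<nabla>u, w) = du(w)\<close> for constant \<open>w\<close> expresses \<open>g(D\<^sub>v \<nabla>u, w)\<close> by the second
  derivative of \<open>u\<close> and a derivative of \<open>g\<close>; the Koszul formula turns the latter into
  \<open>- g(\<Gamma>(v, w), \<nabla>u) - g(\<Gamma>(v, \<nabla>u), w)\<close>.\<close>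

lemma covariant_derivative_gradient:
  assumes c: "c \<in> A" and p: "p \<in> chart_dom c"
  shows "covariant_derivative g (gradient g u) c p v = sharp (g c p) (hessian g u c p v)"
proof (rule sharp_eqI[OF nondegenerate_metric[OF assms] bilinear_metric[OF assms], symmetric])
  fix w
  let ?X = "gradient g u c" and ?S = "chart_map c ` chart_dom c" and ?x = "chart_map c p"
  let ?X' = "frechet_derivative (?X \<circ> chart_inv c) (at ?x)"
  note X = gradient_differentiable[OF assms, unfolded frechet_derivative_works]
  have x: "?x \<in> ?S" using p by blast
  have bil: "bilinear (g c (chart_inv c x))" if "x \<in> ?S" for x
    using that c by (auto simp: chart_inv_map bilinear_metric)
  have "((\<lambda>x. frechet_derivative (u \<circ> chart_inv c) (at x) w) has_derivative
     (\<lambda>h. metric_deriv g c p h (?X p) w + g c p (?X' h) w)) (at ?x)"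
  proof (rule has_derivative_transform_within_open[OF _ open_chart_image[OF c]])
    show "((\<lambda>x. g c (chart_inv c x) ((?X \<circ> chart_inv c) x) w) has_derivative
       (\<lambda>h. metric_deriv g c p h (?X p) w + g c p (?X' h) w)) (at ?x)"
      using has_derivative_bilinear_family[where B = "\<lambda>x. g c (chart_inv c x)",
          OF open_chart_image[OF c] x bil has_derivative_metric[OF assms] X has_derivative_const[of w]]
      by (simp add: chart_inv_map[OF assms] bilinear_rzero[OF bilinear_metric[OF assms]])
  qed (use c p in \<open>auto simp: chart_inv_map gradient_works\<close>)
  from has_derivative_unique[OF has_derivative_du[OF assms] this, THEN fun_cong, of v]
  have "g c p (?X' v) w = hessian g u c p v w + du c p (christoffel g c p v w) - metric_deriv g c p v (?X p) w"
    by simp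
  also have "du c p (christoffel g c p v w) = g c p (christoffel g c p v w) (?X p)"
    by (simp add: gradient_works[OF assms, symmetric] metric_sym[OF assms])
  finally show "g c p (covariant_derivative g (gradient g u) c p v) w = hessian g u c p v w"
    using metric_deriv_sym[OF assms, of v w "?X p"] metric_deriv_sym[OF assms, of w v "?X p"]
    by (simp add: covariant_derivative_def bilinear_ladd[OF bilinear_metric[OF assms]]
        christoffel_works[OF assms] comp_def field_simps)
qed

text \<open>The connection is metric: \<open>v(g(\<nabla>u, \<nabla>u)) = 2 g(\<nabla>\<^sub>v \<nabla>u, \<nabla>u)\<close>. It is obtained by differentiating
  \<open>du(\<nabla>u)\<close> instead, where the Hessian appears once from \<open>du\<close> and once from \<open>\<nabla>u\<close>.\<close>

lemma has_derivative_norm_sq_gradient: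
  assumes c: "c \<in> A" and p: "p \<in> chart_dom c"
  shows "(norm_sq A g (gradient g u) \<circ> chart_inv c has_derivative
    (\<lambda>v. 2 * hessian g u c p v (gradient g u c p))) (at (chart_map c p))"
proof (rule has_derivative_transform_within_open[OF _ open_chart_image[OF c]])
  let ?X = "gradient g u c" and ?x = "chart_map c p"
  let ?X' = "frechet_derivative (?X \<circ> chart_inv c) (at ?x)"
  note X = gradient_differentiable[OF assms, unfolded frechet_derivative_works]
  have x: "?x \<in> chart_map c ` chart_dom c" using p by blast
  have lin: "linear (frechet_derivative (u \<circ> chart_inv c) (at x))" if "x \<in> chart_map c ` chart_dom c" for x
    using that linear_du[OF c] by auto
  have "((\<lambda>x. frechet_derivative (u \<circ> chart_inv c) (at x) ((?X \<circ> chart_inv c) x)) has_derivative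
     (\<lambda>v. hessian g u c p v (?X p) + du c p (christoffel g c p v (?X p)) + du c p (?X' v))) (at ?x)"
    using has_derivative_linear_family[where \<alpha> = "\<lambda>x. frechet_derivative (u \<circ> chart_inv c) (at x)",
        OF open_chart_image[OF c] x lin has_derivative_du[OF assms] X]
    by (simp add: chart_inv_map[OF assms])
  moreover have "hessian g u c p v (?X p) + du c p (christoffel g c p v (?X p)) + du c p (?X' v)
     = 2 * hessian g u c p v (?X p)" for v
  proof -
    have "du c p (covariant_derivative g (gradient g u) c p v) = hessian g u c p v (?X p)"
      unfolding covariant_derivative_gradient[OF assms] gradient_works[OF assms, symmetric]
        metric_sym[OF assms, of "?X p"]
      by (rule sharp_works[OF bilinear_metric[OF assms] nondegenerate_metric[OF assms]])
        (use bilinear_hessian[OF assms] in \<open>simp add: bilinear_def\<close>)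
    then show ?thesis
      by (simp add: covariant_derivative_def linear_add[OF linear_du[OF assms]])
  qed
  ultimately show "((\<lambda>x. frechet_derivative (u \<circ> chart_inv c) (at x) ((?X \<circ> chart_inv c) x)) has_derivative
     (\<lambda>v. 2 * hessian g u c p v (?X p))) (at ?x)" by simp
qed (use c p in \<open>auto simp: chart_inv_map norm_sq_gradient\<close>)

end

section \<open>The product metric\<close>

context pseudo_riemannian
begin

lemma bilinear_product_metric:
  assumes "d \<in> A" "p \<in> chart_dom d"
  shows "bilinear (product_metric \<epsilon>' g (product_chart d) (p, t))"
  using bilinear_metric[OF assms]
  by (simp add: bilinear_def linear_iff product_metric_def algebra_simps)

lemma nondegenerate_product_metric:
  assumes "d \<in> A" "p \<in> chart_dom d" "\<epsilon>' \<noteq> 0"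
  shows "nondegenerate (product_metric \<epsilon>' g (product_chart d) (p, t))"
  unfolding nondegenerate_def
proof (intro allI impI)
  fix v :: "'e \<times> real"
  assume v: "\<forall>w. product_metric \<epsilon>' g (product_chart d) (p, t) v w = 0"
  have "\<forall>w. g d p (fst v) w = 0" using v[rule_format, of "(w, 0)" for w] by (simp add: product_metric_def)
  then have "fst v = 0" using nondegenerate_metric[OF assms(1,2)] unfolding nondegenerate_def by blast
  moreover have "snd v = 0"
    using v[rule_format, of "(0, 1)"] assms(3) bilinear_rzero[OF bilinear_metric[OF assms(1,2)]]
    by (simp add: product_metric_def)
  ultimately show "v = 0" by (simp add: prod_eq_iff)
qed

lemma chart_inv_product_chart:
  assumes "d \<in> A" "p \<in> chart_dom d"
  shows "chart_inv (product_chart d) (chart_map d p, t) = (p, t)"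
proof -
  have "inj_on (chart_map d) (chart_dom d)" 
    by (rule inj_on_inverseI[of _ "chart_inv d"]) (rule chart_inv_map[OF assms(1)])
  then have "inj_on (map_prod (chart_map d) id) (chart_dom d \<times> (UNIV :: real set))"
    by (simp add: map_prod_inj_on)
  from inv_into_f_f[OF this, of "(p, t)"] assms(2) show ?thesis
    by (simp add: chart_inv_def product_chart_def)
qed

text \<open>The components of the product metric do not depend on \<open>t\<close>, and its component in the \<open>t\<close> direction
  is constant.\<close>

lemma metric_deriv_product:
  assumes d: "d \<in> A" and p: "p \<in> chart_dom d"
  shows "metric_deriv (product_metric \<epsilon>' g) (product_chart d) (p, t) z v w =
    metric_deriv g d p (fst z) (fst v) (fst w)"
proof -
  let ?h = "\<lambda>y. product_metric \<epsilon>' g (product_chart d) (chart_inv (product_chart d) y) v w"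
  have "((\<lambda>y. g d (chart_inv d (fst y)) (fst v) (fst w)) has_derivative
      (\<lambda>z. metric_deriv g d p (fst z) (fst v) (fst w))) (at (chart_map d p, t))"
    using diff_chain_at[OF bounded_linear_imp_has_derivative[OF bounded_linear_fst],
        of "\<lambda>y. g d (chart_inv d y) (fst v) (fst w)" "\<lambda>z. metric_deriv g d p z (fst v) (fst w)"
          "(chart_map d p, t)"] has_derivative_metric[OF d p, of "fst v" "fst w"]
    by (simp add: o_def)
  from has_derivative_add[OF this has_derivative_const[of "\<epsilon>' * (snd v * snd w)"]]
  have "((\<lambda>y. g d (chart_inv d (fst y)) (fst v) (fst w) + \<epsilon>' * (snd v * snd w)) has_derivative
      (\<lambda>z. metric_deriv g d p (fst z) (fst v) (fst w))) (at (chart_map d p, t))"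
    by simp
  then have "(?h has_derivative (\<lambda>z. metric_deriv g d p (fst z) (fst v) (fst w))) (at (chart_map d p, t))"
    by (rule has_derivative_transform_within_open[where s = "(chart_map d ` chart_dom d) \<times> UNIV"])
       (use d p in \<open>auto simp: open_Times open_chart_image product_metric_def
          chart_inv_product_chart chart_inv_map\<close>)
  moreover have "chart_map (product_chart d) (p, t) = (chart_map d p, t)"
    by (simp add: product_chart_def)
  ultimately show ?thesis
    unfolding metric_deriv_def[of "product_metric \<epsilon>' g"]
    by (simp flip: frechet_derivative_at)
qed

lemma christoffel_product:
  assumes d: "d \<in> A" and p: "p \<in> chart_dom d" and "\<epsilon>' \<noteq> 0"
  shows "christoffel (product_metric \<epsilon>' g) (product_chart d) (p, t) v w =
    (christoffel g d p (fst v) (fst w), 0)"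
  unfolding christoffel_def[of "product_metric \<epsilon>' g"]
  by (rule sharp_eqI[OF nondegenerate_product_metric[OF assms] bilinear_product_metric[OF d p]])
     (simp add: metric_deriv_product[OF d p], simp add: product_metric_def christoffel_works[OF d p])

end

section \<open>The extrinsic geometry of a graph\<close>

text \<open>The factor \<open>\<real>\<close> of the ambient space has the sign \<open>\<epsilon>'\<close>, and the unit normal of the graph has the sign
  \<open>\<epsilon>\<close>.\<close>

locale graph_hypersurface = C2_function A g u
  for A :: "('a::{t2_space, second_countable_topology}, 'e::euclidean_space) chart set"
    and g :: "('a, 'e) metric" and u :: "'a \<Rightarrow> real" +
  fixes \<epsilon>' \<epsilon> :: real
  assumes eps': "\<epsilon>' \<in> {1, -1}" and eps: "\<epsilon> \<in> {1, -1}"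
    and nondegenerate_graph:
      "nondegenerate_map A (product_charts A) (product_metric \<epsilon>' g) (graph_map u)"
    and sign: "\<forall>p\<in>manifold_points A. sgn (\<epsilon>' + norm_sq A g (gradient g u) p) = \<epsilon>"
begin

abbreviation W :: "'a \<Rightarrow> real" where "W \<equiv> graph_W A g \<epsilon>' \<epsilon> u"
abbreviation \<nu> :: "('a \<times> real, 'e \<times> real) chart \<Rightarrow> 'a \<Rightarrow> 'e \<times> real" where
  "\<nu> \<equiv> upward_normal A g \<epsilon>' \<epsilon> u"

text \<open>The induced metric of the graph; see \<open>induced_metric_graph\<close>.\<close>

definition \<gamma> :: "('a, 'e) metric" where
  "\<gamma> c p v w = g c p v w + \<epsilon>' * (du c p v * du c p w)"

text \<open>The number \<open>L = tr\<^sub>\<gamma> Hess u\<close>, written as the trace of the endomorphism that \<open>\<gamma>\<close> associates with the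
  Hessian of \<open>u\<close> with respect to \<open>g\<close>.\<close>

definition graph_laplacian :: "('a, 'e) chart \<Rightarrow> 'a \<Rightarrow> real" where
  "graph_laplacian c p = endo_trace (\<lambda>v. sharp (\<gamma> c p) (hessian g u c p v))"

lemma eps_simps: "\<epsilon> * \<epsilon> = 1" "\<epsilon>' * \<epsilon>' = 1" "\<epsilon>' \<noteq> 0" "\<epsilon> \<noteq> 0"
  "\<epsilon> * (\<epsilon> * x) = x" "\<epsilon>' * (\<epsilon>' * x) = x"
  using eps eps' by auto

lemma chart_point: "c \<in> A \<Longrightarrow> p \<in> chart_dom c \<Longrightarrow> p \<in> manifold_points A"
  unfolding manifold_points_def by blast

lemma W_squared_pos:
  assumes "p \<in> manifold_points A"
  shows "\<epsilon> * (\<epsilon>' + norm_sq A g (gradient g u) p) > 0"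
  using sign assms eps by (auto simp: sgn_if split: if_splits)

lemma W_pos: "p \<in> manifold_points A \<Longrightarrow> W p > 0"
  using W_squared_pos by (simp add: graph_W_def)

text \<open>This is \<open>W\<^sup>2 = \<epsilon> (\<epsilon>' + |\<nabla>u|\<^sup>2)\<close>, solved for the bracket with \<open>\<epsilon>\<^sup>2 = 1\<close> and with \<open>|\<nabla>u|\<^sup>2\<close> written
  as \<open>du(\<nabla>u)\<close> in an arbitrary chart.\<close>

lemma gradient_slope:
  assumes "c \<in> A" "p \<in> chart_dom c"
  shows "\<epsilon>' + du c p (gradient g u c p) = \<epsilon> * (W p * W p)"
  using W_squared_pos[OF chart_point[OF assms]] eps_simps
  by (simp add: graph_W_def norm_sq_gradient[OF assms])

lemma pushforward_graph:
  assumes c: "c \<in> A" and d: "d \<in> A" and p: "p \<in> chart_dom c" "p \<in> chart_dom d"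
  shows "pushforward c (product_chart d) (graph_map u) p =
    (\<lambda>v. (frechet_derivative (transition c d) (at (chart_map c p)) v, du c p v))"
proof -
  have "local_map c (product_chart d) (graph_map u) = (\<lambda>x. (transition c d x, (u \<circ> chart_inv c) x))"
    by (auto simp: local_map_def product_chart_def graph_map_def transition_def)
  then show ?thesis
    unfolding pushforward_def
    using frechet_derivative_at[OF has_derivative_Pair[OF transition_differentiable[OF assms,
       unfolded frechet_derivative_works] has_derivative_u[OF c p(1)]]] by simp
qed

text \<open>The chart of the target drops out because transition maps are isometries for the components of
  \<open>g\<close>.\<close>

lemma induced_metric_graph:
  assumes c: "c \<in> A" and d: "d \<in> A" and p: "p \<in> chart_dom c" "p \<in> chart_dom d"
  shows "induced_metric (product_metric \<epsilon>' g) c (product_chart d) (graph_map u) p = \<gamma> c p"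
  by (simp add: fun_eq_iff induced_metric_def pushforward_graph[OF assms] product_metric_def
      graph_map_def \<gamma>_def metric_transition[OF assms, symmetric])

lemma graph_in_product_chart:
  "graph_map u p \<in> chart_dom (product_chart d) \<longleftrightarrow> p \<in> chart_dom d"
  by (simp add: graph_map_def product_chart_def)

lemma \<gamma>:
  assumes c: "c \<in> A" and p: "p \<in> chart_dom c"
  shows bilinear_\<gamma>: "bilinear (\<gamma> c p)" and \<gamma>_sym: "\<gamma> c p v w = \<gamma> c p w v"
    and nondegenerate_\<gamma>: "nondegenerate (\<gamma> c p)"
proof -
  show "bilinear (\<gamma> c p)"
    using bilinear_metric[OF assms] linear_du[OF assms]
    by (simp add: bilinear_def linear_iff \<gamma>_def algebra_simps)
  show "\<gamma> c p v w = \<gamma> c p w v" by (simp add: \<gamma>_def metric_sym[OF assms] mult.commute)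
  show "nondegenerate (\<gamma> c p)"
    using nondegenerate_graph[unfolded nondegenerate_map_def, rule_format, of c "product_chart c" p] assms
    by (simp add: induced_metric_graph[OF c c p p] graph_in_product_chart product_charts_def)
qed

text \<open>The tangential part of \<open>\<partial>\<^sub>t\<close> is \<open>dF(\<epsilon> \<nabla>u / W\<^sup>2)\<close> and its normal part is \<open>(\<epsilon> \<epsilon>' / W) \<nu>\<close>. Allowing a
  tangential summand \<open>dF a\<close> lets the lemma serve both for \<open>\<partial>\<^sub>t\<close> and for the second fundamental
  form.\<close>

lemma normal_part_graph:
  assumes c: "c \<in> A" and d: "d \<in> A" and p: "p \<in> chart_dom c" "p \<in> chart_dom d"
  shows "normal_part (product_metric \<epsilon>' g) c (product_chart d) (graph_map u) p
      (pushforward c (product_chart d) (graph_map u) p a + r *\<^sub>R (0, 1)) =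
    (r * \<epsilon> * \<epsilon>' / W p) *\<^sub>R \<nu> (product_chart d) p"
proof -
  let ?J = "frechet_derivative (transition c d) (at (chart_map c p))"
  let ?X = "gradient g u"
  define k where "k = r * \<epsilon> / (W p * W p)"
  have W: "W p \<noteq> 0" using W_pos[OF chart_point[OF c p(1)]] by simp
  have n: "(r * \<epsilon> * \<epsilon>' / W p) *\<^sub>R \<nu> (product_chart d) p = (- k *\<^sub>R ?X d p, k * \<epsilon>')"
    by (simp add: upward_normal_def k_def eps_simps field_simps)
  have kr: "k * (\<epsilon>' + du c p (?X c p)) = r"
    unfolding k_def gradient_slope[OF c p(1)] using W eps_simps by simp
  show ?thesis
    unfolding normal_part_def n
  proof (rule normal_component_eqI)
    show "bilinear (product_metric \<epsilon>' g (product_chart d) (graph_map u p))"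
      unfolding graph_map_def by (rule bilinear_product_metric[OF d p(2)])
    show "linear (pushforward c (product_chart d) (graph_map u) p)"
      unfolding pushforward_graph[OF assms]
      using linear_transition_derivative[OF assms] linear_du[OF c p(1)] by (simp add: linear_iff)
    show "nondegenerate (\<lambda>v w. product_metric \<epsilon>' g (product_chart d) (graph_map u p)
       (pushforward c (product_chart d) (graph_map u) p v)
       (pushforward c (product_chart d) (graph_map u) p w))"
      using nondegenerate_\<gamma>[OF c p(1)] unfolding induced_metric_graph[OF assms, symmetric]
      by (simp add: induced_metric_def[abs_def])
    show "product_metric \<epsilon>' g (product_chart d) (graph_map u p) (- k *\<^sub>R ?X d p, k * \<epsilon>')
      (pushforward c (product_chart d) (graph_map u) p v) = 0" for v
      by (simp add: pushforward_graph[OF assms] product_metric_def graph_map_def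
          bilinear_lmul[OF bilinear_metric[OF d p(2)]] bilinear_lneg[OF bilinear_metric[OF d p(2)]]
          gradient_works[OF d p(2)] du_transition[OF assms] eps_simps)
    show "pushforward c (product_chart d) (graph_map u) p a + r *\<^sub>R (0, 1) =
      (- k *\<^sub>R ?X d p, k * \<epsilon>') + pushforward c (product_chart d) (graph_map u) p (a + k *\<^sub>R ?X c p)"
      using kr
      by (simp add: pushforward_graph[OF assms] gradient_transition[OF assms]
          linear_add[OF linear_transition_derivative[OF assms]]
          linear_cmul[OF linear_transition_derivative[OF assms]]
          linear_add[OF linear_du[OF c p(1)]] linear_cmul[OF linear_du[OF c p(1)]] algebra_simps)
  qed
qed

text \<open>By \<open>christoffel_transition\<close> the horizontal component of the ambient derivative is
  \<open>d\<tau>(\<Gamma>(v, w))\<close>, and the vertical one is \<open>Hess u(v, w) + du(\<Gamma>(v, w))\<close>. Together they are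
  \<open>dF(\<Gamma>(v, w)) + Hess u(v, w) \<partial>\<^sub>t\<close>.\<close>

lemma second_fundamental_form_graph:
  assumes c: "c \<in> A" and d: "d \<in> A" and p: "p \<in> chart_dom c" "p \<in> chart_dom d"
  shows "second_fundamental_form (product_metric \<epsilon>' g) c (product_chart d) (graph_map u) p v w =
    hessian g u c p v w *\<^sub>R (\<epsilon> * \<epsilon>' / W p) *\<^sub>R \<nu> (product_chart d) p"
proof -
  let ?S = "chart_map c ` (chart_dom c \<inter> chart_dom d)"
  let ?T = "transition c d"
  let ?F = "local_map c (product_chart d) (graph_map u)"
  let ?J = "frechet_derivative ?T (at (chart_map c p))"
  let ?D2 = "frechet_derivative (\<lambda>x. frechet_derivative ?T (at x) w) (at (chart_map c p))"
  have x: "chart_map c p \<in> ?S" using p by blast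
  have DF: "(frechet_derivative ?T (at x) w, frechet_derivative (u \<circ> chart_inv c) (at x) w) =
      frechet_derivative ?F (at x) w" if x: "x \<in> ?S" for x
  proof -
    obtain q where "q \<in> chart_dom c" "q \<in> chart_dom d" "x = chart_map c q" using x by blast
    then show ?thesis using pushforward_graph[OF c d, of q] unfolding pushforward_def by metis
  qed
  have "((\<lambda>x. (frechet_derivative ?T (at x) w, frechet_derivative (u \<circ> chart_inv c) (at x) w))
      has_derivative (\<lambda>v. (?D2 v, hessian g u c p v w + du c p (christoffel g c p v w))))
      (at (chart_map c p))"
    by (intro has_derivative_Pair has_derivative_du[OF c p(1)]
        C_2_onD(2)[OF C_2_transition[OF c d] x, unfolded frechet_derivative_works])
  then have "((\<lambda>x. frechet_derivative ?F (at x) w) has_derivative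
      (\<lambda>v. (?D2 v, hessian g u c p v w + du c p (christoffel g c p v w)))) (at (chart_map c p))"
    by (rule has_derivative_transform_within_open[OF _ open_overlap[OF c d] x DF])
  from fun_cong[OF frechet_derivative_at[OF this], of v]
  have D2F: "frechet_derivative (\<lambda>x. frechet_derivative ?F (at x) w) (at (chart_map c p)) v =
      (?D2 v, hessian g u c p v w + du c p (christoffel g c p v w))"
    by (rule sym)
  have "frechet_derivative (\<lambda>x. frechet_derivative ?F (at x) w) (at (chart_map c p)) v +
      christoffel (product_metric \<epsilon>' g) (product_chart d) (graph_map u p)
        (pushforward c (product_chart d) (graph_map u) p v)
        (pushforward c (product_chart d) (graph_map u) p w)
    = (?D2 v + christoffel g d p (?J v) (?J w), hessian g u c p v w + du c p (christoffel g c p v w))"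
    unfolding D2F
    by (simp add: pushforward_graph[OF assms] graph_map_def christoffel_product[OF d p(2) eps_simps(3)])
  also have "\<dots> = pushforward c (product_chart d) (graph_map u) p (christoffel g c p v w)
      + hessian g u c p v w *\<^sub>R (0, 1)"
    by (simp add: pushforward_graph[OF assms] christoffel_transition[OF assms])
  finally show ?thesis
    using normal_part_graph[OF assms, of "christoffel g c p v w" "hessian g u c p v w"]
    by (simp only: second_fundamental_form_def scaleR_scaleR times_divide_eq_right mult.assoc)
qed

lemma mean_curvature_vector_graph:
  assumes c: "c \<in> A" and d: "d \<in> A" and p: "p \<in> chart_dom c" "p \<in> chart_dom d"
  shows "mean_curvature_vector (product_metric \<epsilon>' g) c (product_chart d) (graph_map u) p =
    graph_laplacian c p *\<^sub>R (\<epsilon> * \<epsilon>' / W p) *\<^sub>R \<nu> (product_chart d) p"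
  unfolding mean_curvature_vector_def induced_metric_graph[OF assms]
    second_fundamental_form_graph[OF assms, abs_def] graph_laplacian_def
  by (rule trace_wrt_bilinear[OF bilinear_\<gamma>[OF c p(1)] nondegenerate_\<gamma>[OF c p(1)] \<gamma>_sym[OF c p(1)]
        bilinear_hessian[OF c p(1)]])

lemma sharp_\<gamma>_works:
  assumes "c \<in> A" "p \<in> chart_dom c"
  shows "\<gamma> c p (sharp (\<gamma> c p) (hessian g u c p v)) w = hessian g u c p v w"
  using bilinear_hessian[OF assms]
  by (intro sharp_works bilinear_\<gamma>[OF assms] nondegenerate_\<gamma>[OF assms]) (simp add: bilinear_def)

text \<open>Both \<open>\<gamma>\<close> and the Hessian are tensors, so the endomorphisms of two charts are conjugate by the
  derivative of the transition map.\<close>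

lemma graph_laplacian_chart_independent:
  assumes c: "c \<in> A" and d: "d \<in> A" and p: "p \<in> chart_dom c" "p \<in> chart_dom d"
  shows "graph_laplacian c p = graph_laplacian d p"
  unfolding graph_laplacian_def
proof (rule endo_trace_conjugate[OF linear_transition_derivative[OF assms]
      linear_transition_derivative[OF d c p(2,1)] _ transition_derivative_inverse[OF assms]])
  let ?J = "frechet_derivative (transition c d) (at (chart_map c p))"
  let ?K = "frechet_derivative (transition d c) (at (chart_map d p))"
  show "linear (\<lambda>v. sharp (\<gamma> d p) (hessian g u d p v))"
    by (rule linear_sharp[OF bilinear_\<gamma>[OF d p(2)] nondegenerate_\<gamma>[OF d p(2)] bilinear_hessian[OF d p(2)]])
  show "?J (sharp (\<gamma> c p) (hessian g u c p v)) = sharp (\<gamma> d p) (hessian g u d p (?J v))" for v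
  proof (rule sharp_eqI[OF nondegenerate_\<gamma>[OF d p(2)] bilinear_\<gamma>[OF d p(2)], symmetric])
    fix w
    have w: "w = ?J (?K w)" using transition_derivative_inverse[OF d c p(2,1)] by simp
    have "\<gamma> d p (?J a) (?J b) = \<gamma> c p a b" for a b
      by (simp add: \<gamma>_def metric_transition[OF assms] du_transition[OF assms])
    then have "\<gamma> d p (?J (sharp (\<gamma> c p) (hessian g u c p v))) (?J (?K w)) = hessian g u c p v (?K w)"
      using sharp_\<gamma>_works[OF c p(1)] by simp
    also have "\<dots> = hessian g u d p (?J v) (?J (?K w))" by (rule hessian_transition[OF assms])
    finally show "\<gamma> d p (?J (sharp (\<gamma> c p) (hessian g u c p v))) w = hessian g u d p (?J v) w"
      using w by simp
  qed
qed

text \<open>Let \<open>T\<close> and \<open>S\<close> be the endomorphisms that \<open>g\<close> and \<open>\<gamma>\<close> associate with the Hessian. Since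
  \<open>\<gamma>(z, \<cdot>) = g(z + \<epsilon>' du(z) \<nabla>u, \<cdot>)\<close>, they differ by the rank one map
  \<open>v \<mapsto> \<epsilon>' du(S v) \<nabla>u\<close> of trace \<open>\<epsilon>' du(S \<nabla>u)\<close>. Applying \<open>du\<close> to \<open>T \<nabla>u\<close> determines this number: it
  is \<open>\<epsilon> Hess u(\<nabla>u, \<nabla>u) / W\<^sup>2\<close>.\<close>

lemma trace_hessian:
  assumes c: "c \<in> A" and p: "p \<in> chart_dom c"
  shows "endo_trace (\<lambda>v. sharp (g c p) (hessian g u c p v)) = graph_laplacian c p +
    \<epsilon> / (W p * W p) * hessian g u c p (gradient g u c p) (gradient g u c p)"
proof -
  let ?X = "gradient g u c p"
  define T where "T v = sharp (g c p) (hessian g u c p v)" for v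
  define S where "S v = sharp (\<gamma> c p) (hessian g u c p v)" for v
  have gT: "g c p (T v) w = hessian g u c p v w" for v w
    unfolding T_def using bilinear_hessian[OF assms]
    by (intro sharp_works bilinear_metric[OF assms] nondegenerate_metric[OF assms]) (simp add: bilinear_def)
  have linS: "linear S"
    unfolding S_def
    by (rule linear_sharp[OF bilinear_\<gamma>[OF assms] nondegenerate_\<gamma>[OF assms] bilinear_hessian[OF assms]])
  have TS: "T v = S v + (\<epsilon>' * du c p (S v)) *\<^sub>R ?X" for v
  proof (rule metric_cancel[OF assms])
    show "g c p (T v) w = g c p (S v + (\<epsilon>' * du c p (S v)) *\<^sub>R ?X) w" for w
      using sharp_\<gamma>_works[OF assms, of v w]
      by (simp add: gT bilinear_ladd[OF bilinear_metric[OF assms]]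
          bilinear_lmul[OF bilinear_metric[OF assms]] gradient_works[OF assms] \<gamma>_def S_def mult.assoc)
  qed
  have lin: "linear (\<lambda>v. \<epsilon>' * du c p (S v))"
    using linS linear_du[OF assms] by (simp add: linear_iff algebra_simps)
  have "hessian g u c p ?X ?X = du c p (T ?X)"
    by (simp add: gT[symmetric] metric_sym[OF assms, of _ ?X] gradient_works[OF assms])
  also have "\<dots> = \<epsilon>' * du c p (S ?X) * (\<epsilon>' + du c p ?X)"
    unfolding TS by (simp add: linear_add[OF linear_du[OF assms]] linear_cmul[OF linear_du[OF assms]]
        eps_simps algebra_simps)
  finally have H: "hessian g u c p ?X ?X = \<epsilon>' * du c p (S ?X) * (\<epsilon> * (W p * W p))"
    by (simp add: gradient_slope[OF assms])
  have "endo_trace T = endo_trace S + \<epsilon>' * du c p (S ?X)"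
    unfolding TS[abs_def] endo_trace_add endo_trace_rank_one[OF lin] ..
  moreover have "\<epsilon> / (W p * W p) * hessian g u c p ?X ?X = \<epsilon>' * du c p (S ?X)"
    unfolding H using W_pos[OF chart_point[OF assms]] by (simp add: eps_simps)
  ultimately show ?thesis unfolding T_def S_def graph_laplacian_def by simp
qed

text \<open>The derivative of \<open>1 / W\<close> along \<open>\<nabla>u\<close> is \<open>- \<epsilon> Hess u(\<nabla>u, \<nabla>u) / W\<^sup>3\<close>, which removes exactly the extra
  term of \<open>trace_hessian\<close>.\<close>

lemma divergence_graph:
  assumes p: "p \<in> manifold_points A"
  shows "divergence A g
      (\<lambda>c q. (1 / sqrt (\<epsilon> * (\<epsilon>' + norm_sq A g (gradient g u) q))) *\<^sub>R gradient g u c q) p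
    = graph_laplacian (chart_at A p) p / W p"
proof -
  define c where "c = chart_at A p"
  have c: "c \<in> A" "p \<in> chart_dom c" using chart_at_mem[OF p] by (auto simp: c_def)
  let ?X = "gradient g u c p" and ?n = "norm_sq A g (gradient g u)"
  let ?\<phi> = "\<lambda>q. 1 / sqrt (\<epsilon> * (\<epsilon>' + ?n q))"
  have W: "W p > 0" "sqrt (\<epsilon> * (\<epsilon>' + ?n p)) = W p" using W_pos[OF p] by (simp_all add: graph_W_def)
  have "((\<lambda>s. 1 / sqrt (\<epsilon> * (\<epsilon>' + s))) has_real_derivative - \<epsilon> / (2 * W p ^ 3)) (at (?n p))"
    using W_squared_pos[OF p] W
    by (auto intro!: derivative_eq_intros simp: field_simps power3_eq_cube)
  then have "(?\<phi> \<circ> chart_inv c has_derivative (\<lambda>v. - \<epsilon> * hessian g u c p v ?X / W p ^ 3)) (at (chart_map c p))"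
    using DERIV_compose_FDERIV[OF _ has_derivative_norm_sq_gradient[OF c],
       of "\<lambda>s. 1 / sqrt (\<epsilon> * (\<epsilon>' + s))" "- \<epsilon> / (2 * W p ^ 3)"]
    by (simp add: o_def chart_inv_map[OF c] mult_ac)
  from divergence_scaleR[where X = "gradient g u", OF p c_def this gradient_differentiable[OF c]]
  have "divergence A g (\<lambda>c q. ?\<phi> q *\<^sub>R gradient g u c q) p =
      endo_trace (\<lambda>v. sharp (g c p) (hessian g u c p v)) / W p - \<epsilon> * hessian g u c p ?X ?X / W p ^ 3"
    unfolding W(2)
    by (simp add: divergence_def endo_trace_def c_def[symmetric] covariant_derivative_gradient[OF c])
  also have "\<dots> = graph_laplacian c p / W p"
    unfolding trace_hessian[OF c] using W(1) by (simp add: field_simps power3_eq_cube)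
  finally show ?thesis by (simp add: c_def)
qed

lemma upward_normal_nonzero: "p \<in> manifold_points A \<Longrightarrow> \<nu> d p \<noteq> 0"
  using W_pos[of p] by (simp add: upward_normal_def zero_prod_def)

text \<open>The description in \<open>mean_curvature\<close> denotes because the mean curvature vectors in all pairs of
  charts have the same coefficient along \<open>\<nu>\<close>, and \<open>\<nu>\<close> does not vanish.\<close>

lemma graph_mean_curvature_eq:
  assumes c: "c \<in> A" and p: "p \<in> chart_dom c"
  shows "graph_mean_curvature A g \<epsilon>' \<epsilon> u p = \<epsilon>' * graph_laplacian c p / W p"
  unfolding graph_mean_curvature_def mean_curvature_def
proof (rule the_equality)
  show "\<forall>c'\<in>A. \<forall>d\<in>product_charts A. p \<in> chart_dom c' \<longrightarrow> graph_map u p \<in> chart_dom d \<longrightarrow>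
     mean_curvature_vector (product_metric \<epsilon>' g) c' d (graph_map u) p =
     (\<epsilon> * (\<epsilon>' * graph_laplacian c p / W p)) *\<^sub>R \<nu> d p"
  proof (intro ballI impI)
    fix c' d assume c': "c' \<in> A" "p \<in> chart_dom c'" and "d \<in> product_charts A" "graph_map u p \<in> chart_dom d"
    then obtain e where e: "e \<in> A" "p \<in> chart_dom e" "d = product_chart e"
      unfolding product_charts_def by (auto simp: graph_in_product_chart)
    show "mean_curvature_vector (product_metric \<epsilon>' g) c' d (graph_map u) p =
     (\<epsilon> * (\<epsilon>' * graph_laplacian c p / W p)) *\<^sub>R \<nu> d p"
      unfolding e(3) mean_curvature_vector_graph[OF c'(1) e(1) c'(2) e(2)]
        graph_laplacian_chart_independent[OF c'(1) c c'(2) p] by (simp add: mult_ac)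
  qed
next
  fix H
  assume "\<forall>c'\<in>A. \<forall>d\<in>product_charts A. p \<in> chart_dom c' \<longrightarrow> graph_map u p \<in> chart_dom d \<longrightarrow>
     mean_curvature_vector (product_metric \<epsilon>' g) c' d (graph_map u) p = (\<epsilon> * H) *\<^sub>R \<nu> d p"
  then have "mean_curvature_vector (product_metric \<epsilon>' g) c (product_chart c) (graph_map u) p =
      (\<epsilon> * H) *\<^sub>R \<nu> (product_chart c) p"
    using assms by (simp add: product_charts_def graph_in_product_chart)
  then have "(graph_laplacian c p * (\<epsilon> * \<epsilon>' / W p)) *\<^sub>R \<nu> (product_chart c) p = (\<epsilon> * H) *\<^sub>R \<nu> (product_chart c) p"
    by (simp add: mean_curvature_vector_graph[OF c c p p])
  then have "graph_laplacian c p * (\<epsilon> * \<epsilon>' / W p) = \<epsilon> * H"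
    using upward_normal_nonzero[OF chart_point[OF assms]] by simp
  then have "\<epsilon> * H = \<epsilon> * (\<epsilon>' * graph_laplacian c p / W p)" by (simp add: mult_ac)
  then show "H = \<epsilon>' * graph_laplacian c p / W p"
    using eps_simps(4) mult_left_cancel by blast
qed

text \<open>Both sides of the soliton equation are multiples of the nonzero vector \<open>(\<epsilon> \<epsilon>' / W) \<nu>\<close>, with the
  coefficients \<open>L\<close> and \<open>1\<close>.\<close>

lemma translating_soliton_iff:
  "translating_soliton A A g \<epsilon>' (graph_map u) \<longleftrightarrow> (\<forall>c\<in>A. \<forall>p\<in>chart_dom c. graph_laplacian c p = 1)"
proof -
  have key: "mean_curvature_vector (product_metric \<epsilon>' g) c (product_chart d) (graph_map u) p =
      normal_part (product_metric \<epsilon>' g) c (product_chart d) (graph_map u) p (0, 1) \<longleftrightarrow>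
      graph_laplacian c p = 1"
    if "c \<in> A" "d \<in> A" "p \<in> chart_dom c" "p \<in> chart_dom d" for c d p
  proof -
    have "pushforward c (product_chart d) (graph_map u) p 0 = 0"
      unfolding pushforward_graph[OF that] using linear_0[OF linear_transition_derivative[OF that]]
        linear_0[OF linear_du[OF that(1,3)]] by (simp add: zero_prod_def)
    then have "normal_part (product_metric \<epsilon>' g) c (product_chart d) (graph_map u) p (0, 1) =
        (\<epsilon> * \<epsilon>' / W p) *\<^sub>R \<nu> (product_chart d) p"
      using normal_part_graph[OF that, of 0 1] by simp
    moreover have "(\<epsilon> * \<epsilon>' / W p) *\<^sub>R \<nu> (product_chart d) p \<noteq> 0"
      using upward_normal_nonzero W_pos[of p] chart_point[OF that(1,3)] eps_simps by simp
    ultimately show ?thesis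
      unfolding mean_curvature_vector_graph[OF that] by (metis scaleR_cancel_right scaleR_one)
  qed
  show ?thesis
    unfolding translating_soliton_def product_charts_def
    by (auto simp: graph_in_product_chart key)
qed

end

section \<open>Translating solitons\<close>

theorem proposition2p1:
  fixes A :: "('a::{t2_space, second_countable_topology}, 'e::euclidean_space) chart set"
    and g :: "('a, 'e) metric"
    and \<epsilon>' \<epsilon> :: real
    and u :: "'a \<Rightarrow> real"
  assumes "pseudo_riemannian_manifold A g"
    and "connected (manifold_points A)"
    and "\<epsilon>' \<in> {1, -1}"
    and "C_k_function 2 A u"
    and "nondegenerate_map A (product_charts A) (product_metric \<epsilon>' g) (graph_map u)"
    and "\<epsilon> \<in> {1, -1}"
    and "\<forall>p\<in>manifold_points A. sgn (\<epsilon>' + norm_sq A g (gradient g u) p) = \<epsilon>"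
  shows "translating_soliton A A g \<epsilon>' (graph_map u) \<longleftrightarrow>
    (\<forall>p\<in>manifold_points A.
       divergence A g
         (\<lambda>c q. (1 / sqrt (\<epsilon> * (\<epsilon>' + norm_sq A g (gradient g u) q))) *\<^sub>R gradient g u c q) p
         = 1 / sqrt (\<epsilon> * (\<epsilon>' + norm_sq A g (gradient g u) p)) \<and>
       1 / sqrt (\<epsilon> * (\<epsilon>' + norm_sq A g (gradient g u) p))
         = \<epsilon>' * graph_mean_curvature A g \<epsilon>' \<epsilon> u p)"
    (is "_ \<longleftrightarrow> (\<forall>p\<in>_. ?E p)")
proof -
  interpret graph_hypersurface A g u \<epsilon>' \<epsilon>
    by unfold_locales (fact assms)+
  \<comment> \<open>The two equations at \<open>p\<close> read \<open>L / W = 1 / W\<close> and \<open>1 / W = \<epsilon>' (\<epsilon>' L / W)\<close>.\<close>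
  have "?E p \<longleftrightarrow> graph_laplacian (chart_at A p) p = 1" if p: "p \<in> manifold_points A" for p
    unfolding divergence_graph[OF p] graph_mean_curvature_eq[OF chart_at_mem[OF p]]
    unfolding graph_W_def[symmetric]
    using W_pos[OF p] by (auto simp: eps_simps)
  moreover have "(\<forall>c\<in>A. \<forall>p\<in>chart_dom c. graph_laplacian c p = 1) \<longleftrightarrow>
      (\<forall>p\<in>manifold_points A. graph_laplacian (chart_at A p) p = 1)"
    using chart_at_mem chart_point graph_laplacian_chart_independent by metis
  ultimately show ?thesis unfolding translating_soliton_iff by simp
qed

end
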